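(* Let $0<r<1$, $k=\sqrt{1-r^2}$, and for integers $n\ge0$ let $\tilde\Phi_{r,n}(x)=\frac1\pi\int_0^\pi e^{-x\operatorname{dn}(K(k)\theta/\pi,k)}\cos(n\theta)\,d\theta$. For every integer $n\ge1$, $\tilde\Phi_{r,n}(x)$ vanishes exactly $n-1$ times on $(0,\infty)$ and changes sign at each zero. For every integer $n\ge2$, $\tilde\Phi_{r,n}(x)$ changes sign between any two successive zeros of $\tilde\Phi_{r,n+1}(x)$ on $(0,\infty)$.
   Context: $K(k)=\int_0^{\pi/2}(1-k^2\sin^2\theta)^{-1/2}d\theta$ is the complete elliptic integral of the first kind with modulus $k$, and $\operatorname{dn}(\cdot,k)$ is Jacobi's delta amplitude function with modulus $k$. *)

theory Defs
  imports "HOL-Analysis.Analysis"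
begin

text \<open>
  Elliptic integrals and Jacobi functions are parametrised by the modulus \<open>k\<close>
  (not by the parameter \<open>m = k\<^sup>2\<close>), and are intended for \<open>\<bar>k\<bar> < 1\<close>.
  The integral over \<open>0..\<phi>\<close> is oriented, so \<open>elliptic_F\<close> is odd in \<open>\<phi>\<close>.
\<close>

definition elliptic_F :: "real \<Rightarrow> real \<Rightarrow> real" where
  "elliptic_F \<phi> k = (LBINT \<theta>=0..\<phi>. 1 / sqrt (1 - k\<^sup>2 * (sin \<theta>)\<^sup>2))"

definition elliptic_K :: "real \<Rightarrow> real" where
  "elliptic_K k = (LBINT \<theta>=0..ereal (pi / 2). 1 / sqrt (1 - k\<^sup>2 * (sin \<theta>)\<^sup>2))"

text \<open>
  For \<open>\<bar>k\<bar> < 1\<close> the map \<open>\<phi> \<mapsto> elliptic_F \<phi> k\<close> is a strictly increasing bijection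
  of the real line, because its integrand is at least 1; the amplitude is its inverse.
\<close>

definition jacobi_am :: "real \<Rightarrow> real \<Rightarrow> real" where
  "jacobi_am u k = (THE \<phi>. elliptic_F \<phi> k = u)"

definition jacobi_dn :: "real \<Rightarrow> real \<Rightarrow> real" where
  "jacobi_dn u k = sqrt (1 - k\<^sup>2 * (sin (jacobi_am u k))\<^sup>2)"

definition Phi_tilde :: "real \<Rightarrow> nat \<Rightarrow> real \<Rightarrow> real" where
  "Phi_tilde r n x =
     (let k = sqrt (1 - r\<^sup>2)
      in 1 / pi * (LBINT \<theta>=0..pi. exp (- x * jacobi_dn (elliptic_K k * \<theta> / pi) k) * cos (real n * \<theta>)))"

definition changes_sign_at :: "(real \<Rightarrow> real) \<Rightarrow> real \<Rightarrow> bool" where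
  "changes_sign_at f z \<longleftrightarrow>
     (\<exists>\<epsilon>>0. \<forall>x\<in>{z - \<epsilon><..<z}. \<forall>y\<in>{z<..<z + \<epsilon>}. f x * f y < 0)"

definition changes_sign_on :: "(real \<Rightarrow> real) \<Rightarrow> real set \<Rightarrow> bool" where
  "changes_sign_on f S \<longleftrightarrow> (\<exists>x\<in>S. \<exists>y\<in>S. f x < 0 \<and> 0 < f y)"

definition positive_zeros :: "(real \<Rightarrow> real) \<Rightarrow> real set" where
  "positive_zeros f = {x. 0 < x \<and> f x = 0}"

definition successive_positive_zeros :: "(real \<Rightarrow> real) \<Rightarrow> real \<Rightarrow> real \<Rightarrow> bool" where
  "successive_positive_zeros f a b \<longleftrightarrow>
     a \<in> positive_zeros f \<and> b \<in> positive_zeros f \<and> a < b \<and> {a<..<b} \<inter> positive_zeros f = {}"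

end

theory Submission
  imports Defs "HOL-Computational_Algebra.Polynomial"
begin

text \<open>
  Write \<open>y(\<theta>) = dn(K\<theta>/\<pi>)\<close> and \<open>\<Phi>\<^sub>n(x) = \<integral> exp(-x y(\<theta>)) cos(n\<theta>) d\<theta>\<close> over \<open>[0, \<pi>]\<close>.

  Upper bound: a combination of \<open>\<Phi>\<^sub>0, \<dots>, \<Phi>\<^sub>N\<close> is the Laplace-type transform of a polynomial of degree
  at most \<open>N\<close> in \<open>cos \<theta>\<close>, so variation diminishing allows it at most \<open>N\<close> real zeros
  with multiplicity; for \<open>\<Phi>\<^sub>1, \<dots>, \<Phi>\<^sub>N\<close> one of them is \<open>0\<close>, which leaves \<open>N - 1\<close> positive ones.

  Lower bound: the differential equations of \<open>dn\<close> make \<open>\<Phi>\<^sub>n\<close> an eigenfunction, with eigenvalue proportional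
  to \<open>n\<^sup>2\<close>, of a fourth-order operator that is self-adjoint with respect to \<open>dx/x\<close>. Hence the
  \<open>\<Phi>\<^sub>n\<close>, \<open>n \<ge> 1\<close>, are orthogonal with respect to \<open>dx/x\<close> on \<open>(0, \<infinity>)\<close>. A combination of
  \<open>\<Phi>\<^sub>p, \<Phi>\<^sub>p\<^sub>+\<^sub>1, \<dots>\<close> with fewer than \<open>p - 1\<close> sign changes could be multiplied by a combination of
  \<open>\<Phi>\<^sub>1, \<dots>, \<Phi>\<^sub>p\<^sub>-\<^sub>1\<close> changing sign at exactly the same points, contradicting orthogonality.

  Interlacing: by both bounds every combination of \<open>\<Phi>\<^sub>n\<close> and \<open>\<Phi>\<^sub>n\<^sub>+\<^sub>1\<close> has only simple positive
  zeros, so the Wronskian of \<open>\<Phi>\<^sub>n\<close> and \<open>\<Phi>\<^sub>n\<^sub>+\<^sub>1\<close> has no positive zero.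
\<close>

section \<open>Zeros and sign changes of real functions\<close>

lemma Rolle_finite_set:
  fixes f f' :: "real \<Rightarrow> real"
  assumes "finite Z" and deriv: "\<And>x. (f has_real_derivative f' x) (at x)"
    and "\<And>z. z \<in> Z \<Longrightarrow> f z = 0"
  shows "\<exists>W. finite W \<and> W \<inter> Z = {} \<and> card Z \<le> Suc (card W) \<and>
    (\<forall>w\<in>W. f' w = 0 \<and> (\<exists>z\<in>Z. w < z))"
  using assms(1,3)
proof (induction Z rule: finite_linorder_max_induct)
  case empty
  then show ?case by (intro exI[of _ "{}"]) auto
next
  case (insert b Z)
  then obtain W where W: "finite W" "W \<inter> Z = {}" "card Z \<le> Suc (card W)"
      "\<forall>w\<in>W. f' w = 0 \<and> (\<exists>z\<in>Z. w < z)" by auto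
  show ?case
  proof (cases "Z = {}")
    case True
    then show ?thesis by (intro exI[of _ "{}"]) auto
  next
    case False
    define m where "m = Max Z"
    have m: "m \<in> Z" "\<And>z. z \<in> Z \<Longrightarrow> z \<le> m" "m < b"
      using insert False by (auto simp: m_def)
    have "\<exists>\<xi>>m. \<xi> < b \<and> (*) (f' \<xi>) = (\<lambda>v. 0)"
    proof (rule Rolle_deriv[OF m(3)])
      show "f m = f b" using insert.prems m(1) by simp
      show "continuous_on {m..b} f"
        using deriv by (meson DERIV_continuous_on has_field_derivative_at_within)
      show "(f has_derivative (*) (f' x)) (at x)" for x
        using deriv[of x] by (simp add: has_field_derivative_def)
    qed
    then obtain \<xi> where \<xi>: "m < \<xi>" "\<xi> < b" "f' \<xi> = 0"
      by (metis mult.right_neutral)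
    have "\<xi> \<notin> Z" "\<xi> \<notin> W" using m \<xi> W(4) by (fastforce dest: m(2))+
    then show ?thesis
      using W insert.hyps \<xi> m
      by (intro exI[of _ "insert \<xi> W"]) (auto 0 4 dest: m(2))
  qed
qed

text \<open>Gaussian elimination with fewer equations (\<open>Z\<close>) than unknowns
  (\<open>J\<close>). It will produce combinations of the \<open>\<Phi> j\<close> that vanish at
  prescribed points.\<close>

lemma homogeneous_system_nontrivial_solution:
  fixes f :: "'i \<Rightarrow> 'a \<Rightarrow> real"
  assumes "finite Z" "finite J" "card Z < card J"
  shows "\<exists>a. (\<exists>j\<in>J. a j \<noteq> 0) \<and> (\<forall>z\<in>Z. (\<Sum>j\<in>J. a j * f j z) = 0)"
  using assms
proof (induction Z arbitrary: J f rule: finite_induct)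
  case empty
  then show ?case by (intro exI[of _ "\<lambda>_. 1"]) (auto simp: card_gt_0_iff)
next
  case (insert z Z)
  show ?case
  proof (cases "\<forall>j\<in>J. f j z = 0")
    case True
    have "card Z < card J" using insert by simp
    with insert.IH[OF insert.prems(1), of f] True show ?thesis by auto
  next
    case False
    then obtain p where p: "p \<in> J" "f p z \<noteq> 0" by blast
    \<comment> \<open>The pivot \<open>p\<close> eliminates the equation at \<open>z\<close>: every
      \<open>g j\<close> vanishes there. The value of \<open>b p\<close> below is the back
      substitution.\<close>
    define g where "g j x = f j x - f j z / f p z * f p x" for j x
    have "card Z < card (J - {p})" using insert p by simp
    with insert.IH[of "J - {p}" g] insert.prems
    obtain a where a: "\<exists>j\<in>J-{p}. a j \<noteq> 0" "\<forall>x\<in>Z. (\<Sum>j\<in>J-{p}. a j * g j x) = 0"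
      by auto
    define b where "b = a(p := - (\<Sum>j\<in>J-{p}. a j * f j z / f p z))"
    have "(\<Sum>j\<in>J. b j * f j x) = (\<Sum>j\<in>J-{p}. a j * g j x)" for x
    proof -
      have "(\<Sum>j\<in>J. b j * f j x) = b p * f p x + (\<Sum>j\<in>J-{p}. b j * f j x)"
        using insert.prems p by (simp add: sum.remove)
      also have "(\<Sum>j\<in>J-{p}. b j * f j x) = (\<Sum>j\<in>J-{p}. a j * f j x)"
        by (rule sum.cong) (auto simp: b_def)
      finally show ?thesis
        by (simp add: b_def g_def sum_subtractf sum_distrib_left sum_distrib_right algebra_simps)
    qed
    moreover have "g j z = 0" for j using p by (simp add: g_def)
    ultimately show ?thesis using a
      by (intro exI[of _ b]) (auto simp: b_def)
  qed
qed

section \<open>Cosine sums as polynomials in the cosine\<close>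

lemma cos_multiple_polynomial:
  "\<exists>P::real poly. degree P \<le> n \<and> coeff P n \<noteq> 0 \<and> (\<forall>x. poly P (cos x) = cos (real n * x))"
proof (induction n rule: induct_nat_012)
  case 0
  then show ?case by (intro exI[of _ 1]) auto
next
  case 1
  then show ?case by (intro exI[of _ "[:0, 1:]"]) auto
next
  case (ge2 n)
  then obtain P Q :: "real poly" where
    P: "degree P \<le> n" "\<And>x. poly P (cos x) = cos (real n * x)" and
    Q: "degree Q \<le> Suc n" "coeff Q (Suc n) \<noteq> 0" "\<And>x. poly Q (cos x) = cos (real (Suc n) * x)"
    by metis
  \<comment> \<open>The Chebyshev recurrence; \<open>pCons 0\<close> multiplies by the
    variable.\<close>
  define R where "R = pCons 0 (smult 2 Q) - P"
  have "poly R (cos x) = cos (real (Suc (Suc n)) * x)" for x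
    using cos_plus_cos[of "real (Suc (Suc n)) * x" "real n * x"]
    by (simp add: R_def P Q algebra_simps diff_divide_distrib add_divide_distrib)
  moreover have "degree R \<le> Suc (Suc n)"
    unfolding R_def using P Q by (intro degree_diff_le) (auto simp: degree_pCons_eq_if)
  moreover have "coeff R (Suc (Suc n)) \<noteq> 0"
    using P Q by (simp add: R_def coeff_eq_0)
  ultimately show ?case by blast
qed

text \<open>The term of largest index with nonzero coefficient has strictly larger degree than all
  others, so nothing cancels it.\<close>

lemma cos_sum_polynomial:
  fixes a :: "nat \<Rightarrow> real"
  assumes "\<exists>i\<le>N. a i \<noteq> 0"
  shows "\<exists>P::real poly. P \<noteq> 0 \<and> degree P \<le> N \<and> (\<forall>x. poly P (cos x) = (\<Sum>i\<le>N. a i * cos (real i * x)))"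
  using assms
proof (induction N)
  case 0
  then show ?case by (intro exI[of _ "[:a 0:]"]) auto
next
  case (Suc N)
  show ?case
  proof (cases "a (Suc N) = 0")
    case True
    then have "\<exists>i\<le>N. a i \<noteq> 0" using Suc.prems le_Suc_eq by metis
    from Suc.IH[OF this] True show ?thesis by (auto intro: le_SucI)
  next
    case False
    \<comment> \<open>The lower coefficients may all vanish; the induction hypothesis then says
      nothing and \<open>P\<close> is 0.\<close>
    have "\<exists>P::real poly. degree P \<le> N \<and> (\<forall>x. poly P (cos x) = (\<Sum>i\<le>N. a i * cos (real i * x)))"
    proof (cases "\<exists>i\<le>N. a i \<noteq> 0")
      case True
      with Suc.IH show ?thesis by blast
    next
      case False
      then show ?thesis by (intro exI[of _ 0]) auto
    qed
    then obtain P :: "real poly" where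
      P: "degree P \<le> N" "\<And>x. poly P (cos x) = (\<Sum>i\<le>N. a i * cos (real i * x))" by blast
    obtain Q :: "real poly" where Q: "degree Q \<le> Suc N" "coeff Q (Suc N) \<noteq> 0"
      "\<And>x. poly Q (cos x) = cos (real (Suc N) * x)"
      using cos_multiple_polynomial by blast
    define R where "R = P + smult (a (Suc N)) Q"
    have "coeff R (Suc N) \<noteq> 0"
      using P Q False by (simp add: R_def coeff_eq_0)
    then have "R \<noteq> 0" by auto
    moreover have "degree R \<le> Suc N" unfolding R_def
      by (intro degree_add_le le_trans[OF degree_smult_le]) (use P Q in auto)
    ultimately show ?thesis using P Q by (intro exI[of _ R]) (auto simp: R_def)
  qed
qed

text \<open>\<open>cos\<close> maps \<open>{0..pi}\<close> onto \<open>{-1..1}\<close>, so a cosine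
  sum vanishing there would give a nonzero polynomial infinitely many roots.\<close>

lemma cos_sum_nonzero:
  fixes a :: "nat \<Rightarrow> real"
  assumes "\<exists>i\<le>N. a i \<noteq> 0"
  shows "\<exists>x\<in>{0..pi}. (\<Sum>i\<le>N. a i * cos (real i * x)) \<noteq> 0"
proof (rule ccontr)
  assume *: "\<not> ?thesis"
  obtain P :: "real poly" where P: "P \<noteq> 0" "\<And>x. poly P (cos x) = (\<Sum>i\<le>N. a i * cos (real i * x))"
    using cos_sum_polynomial[of N a] assms by blast
  have "{-1..1} \<subseteq> {c. poly P c = 0}"
  proof
    fix c :: real assume "c \<in> {-1..1}"
    then have "arccos c \<in> {0..pi}" "cos (arccos c) = c"
      using arccos_lbound arccos_ubound by auto
    with * P(2)[of "arccos c"] have "poly P c = 0" by auto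
    then show "c \<in> {c. poly P c = 0}" by simp
  qed
  then have "finite {-1..1::real}" using P(1) poly_roots_finite finite_subset by blast
  then show False using infinite_Icc[of "-1 :: real" 1] by simp
qed

section \<open>Sign behaviour of continuous functions around their zeros\<close>

lemma no_zeros_imp_same_sign:
  fixes f :: "real \<Rightarrow> real"
  assumes "continuous_on {a<..<b} f" "\<And>x. a < x \<Longrightarrow> x < b \<Longrightarrow> f x \<noteq> 0"
    "a < x" "x < b" "a < y" "y < b"
  shows "f x * f y > 0"
proof -
  have *: "f x * f y > 0" if "x \<le> y" "a < x" "y < b" for x y
  proof (rule ccontr)
    assume "\<not> ?thesis"
    then have "f x < 0 \<and> 0 < f y \<or> f y < 0 \<and> 0 < f x"
      using assms(2)[of x] assms(2)[of y] that by (auto simp: zero_less_mult_iff)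
    moreover have "continuous_on {x..y} f"
      using assms(1) by (rule continuous_on_subset) (use that in auto)
    ultimately have "\<exists>c\<ge>x. c \<le> y \<and> f c = 0"
      using IVT'[of f x 0 y] IVT2'[of f y 0 x] that by force
    then show False using assms(2) that by (metis less_le_trans le_less_trans)
  qed
  show ?thesis using *[of x y] *[of y x] assms by (cases "x \<le> y") (auto simp: mult.commute)
qed

text \<open>Counterpart of \<open>changes_sign_at\<close>. As the value at \<open>z\<close> does not
  enter, it covers zeros without sign change and nonzero values alike.\<close>

definition same_sign_around :: "(real \<Rightarrow> real) \<Rightarrow> real \<Rightarrow> bool" where
  "same_sign_around f z \<longleftrightarrow> (\<exists>\<epsilon>>0. \<forall>x\<in>{z - \<epsilon><..<z}. \<forall>y\<in>{z<..<z + \<epsilon>}. f x * f y > 0)"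

text \<open>Finitely many zeros leave a punctured neighbourhood of \<open>z\<close> free of them,
  and on each side of \<open>z\<close> the sign is constant.\<close>

lemma isolated_zero_sign_cases:
  fixes f :: "real \<Rightarrow> real"
  assumes cont: "continuous_on {0<..} f" and fin: "finite (positive_zeros f)" and "0 < z"
  shows "changes_sign_at f z \<or> same_sign_around f z"
proof -
  obtain d where d: "d > 0" "\<And>x. x \<in> positive_zeros f \<Longrightarrow> x \<noteq> z \<Longrightarrow> d \<le> dist z x"
    using finite_set_avoid[OF fin, of z] by blast
  define e where "e = min d z"
  have e: "e > 0" "e \<le> d" "e \<le> z" using d assms by (auto simp: e_def)
  have nz: "f x \<noteq> 0" if "z - e < x" "x < z + e" "x \<noteq> z" for x
    using d(2)[of x] that e by (auto simp: positive_zeros_def dist_real_def)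
  have L: "f x * f y > 0" if "x \<in> {z-e<..<z}" "y \<in> {z-e<..<z}" for x y
    by (rule no_zeros_imp_same_sign[of "z-e" z])
      (use that e nz in \<open>auto intro!: continuous_on_subset[OF cont]\<close>)
  have R: "f x * f y > 0" if "x \<in> {z<..<z+e}" "y \<in> {z<..<z+e}" for x y
    by (rule no_zeros_imp_same_sign[of z "z+e"])
      (use that e nz in \<open>auto intro!: continuous_on_subset[OF cont]\<close>)
  have l: "z - e/2 \<in> {z-e<..<z}" and r: "z + e/2 \<in> {z<..<z+e}" using e by auto
  consider "f (z - e/2) * f (z + e/2) < 0" | "f (z - e/2) * f (z + e/2) > 0"
    using nz[of "z - e/2"] nz[of "z + e/2"] e by (fastforce simp: mult_less_0_iff zero_less_mult_iff)
  then show ?thesis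
  proof cases
    case 1
    have "f x * f y < 0" if "x \<in> {z-e<..<z}" "y \<in> {z<..<z+e}" for x y
      using 1 L[OF that(1) l] R[OF that(2) r] by (auto simp: mult_less_0_iff zero_less_mult_iff)
    then show ?thesis using e by (auto simp: changes_sign_at_def)
  next
    case 2
    have "f x * f y > 0" if "x \<in> {z-e<..<z}" "y \<in> {z<..<z+e}" for x y
      using 2 L[OF that(1) l] R[OF that(2) r] by (auto simp: mult_less_0_iff zero_less_mult_iff)
    then show ?thesis using e by (auto simp: same_sign_around_def)
  qed
qed

lemma changes_sign_at_imp_not_same_sign_around:
  assumes "changes_sign_at f z" shows "\<not> same_sign_around f z"
proof
  assume "same_sign_around f z"
  then obtain d where d: "d > 0" "\<And>x y. x \<in> {z-d<..<z} \<Longrightarrow> y \<in> {z<..<z+d} \<Longrightarrow> f x * f y > 0"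
    unfolding same_sign_around_def by blast
  obtain e where e: "e > 0" "\<And>x y. x \<in> {z-e<..<z} \<Longrightarrow> y \<in> {z<..<z+e} \<Longrightarrow> f x * f y < 0"
    using assms unfolding changes_sign_at_def by blast
  have "min d e / 2 < d" "min d e / 2 < e" "0 < min d e / 2" using d(1) e(1) by auto
  then show False
    using d(2)[of "z - min d e / 2" "z + min d e / 2"] e(2)[of "z - min d e / 2" "z + min d e / 2"]
    by auto
qed

lemma same_sign_around_mult:
  assumes "changes_sign_at f z \<and> changes_sign_at g z \<or> same_sign_around f z \<and> same_sign_around g z"
  shows "same_sign_around (\<lambda>x. f x * g x) z"
proof -
  obtain d e where "d > 0" "e > 0" and de:
    "(\<forall>x\<in>{z-d<..<z}. \<forall>y\<in>{z<..<z+d}. f x * f y < 0) \<and> (\<forall>x\<in>{z-e<..<z}. \<forall>y\<in>{z<..<z+e}. g x * g y < 0) \<or>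
     (\<forall>x\<in>{z-d<..<z}. \<forall>y\<in>{z<..<z+d}. f x * f y > 0) \<and> (\<forall>x\<in>{z-e<..<z}. \<forall>y\<in>{z<..<z+e}. g x * g y > 0)"
    using assms unfolding changes_sign_at_def same_sign_around_def by blast
  have "f x * g x * (f y * g y) > 0"
    if "x \<in> {z - min d e<..<z}" "y \<in> {z<..<z + min d e}" for x y
  proof -
    have "f x * f y < 0 \<and> g x * g y < 0 \<or> f x * f y > 0 \<and> g x * g y > 0"
      using de that by auto
    then have "(f x * f y) * (g x * g y) > 0" by (auto simp: zero_less_mult_iff)
    then show ?thesis by (simp add: mult_ac)
  qed
  then show ?thesis unfolding same_sign_around_def using \<open>d > 0\<close> \<open>e > 0\<close>
    by (intro exI[of _ "min d e"]) auto
qed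

text \<open>Induction on the number of zeros between \<open>x\<close> and \<open>y\<close>: the
  local hypothesis bridges one zero, and each remaining side contains fewer.\<close>

lemma same_sign_around_everywhere_imp_same_sign:
  fixes f :: "real \<Rightarrow> real"
  assumes cont: "continuous_on {0<..} f" and fin: "finite (positive_zeros f)"
    and loc: "\<And>z. z \<in> positive_zeros f \<Longrightarrow> same_sign_around f z"
    and "0 < x" "x < y" "f x \<noteq> 0" "f y \<noteq> 0"
  shows "f x * f y > 0"
  using assms(4-)
proof (induction "card (positive_zeros f \<inter> {x<..<y})" arbitrary: x y rule: less_induct)
  case less
  show ?case
  proof (cases "positive_zeros f \<inter> {x<..<y} = {}")
    case True
    have nz: "f u \<noteq> 0" if "x \<le> u" "u \<le> y" for u
    proof (cases "u = x \<or> u = y")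
      case False
      then have "u \<in> {x<..<y}" using that by auto
      then have "u \<notin> positive_zeros f" using True by blast
      then show ?thesis using that less.prems by (simp add: positive_zeros_def)
    qed (use less.prems in auto)
    show ?thesis
    proof (rule ccontr)
      assume "\<not> ?thesis"
      then have "f x < 0 \<and> 0 < f y \<or> f y < 0 \<and> 0 < f x"
        using less.prems by (auto simp: zero_less_mult_iff)
      moreover have "continuous_on {x..y} f"
        using cont by (rule continuous_on_subset) (use less.prems in auto)
      ultimately have "\<exists>c\<ge>x. c \<le> y \<and> f c = 0"
        using IVT'[of f x 0 y] IVT2'[of f y 0 x] less.prems by force
      then show False using nz by blast
    qed
  next
    case False
    then obtain z where z: "z \<in> positive_zeros f" "x < z" "z < y" by auto
    obtain d where d: "d > 0" "\<And>u v. u \<in> {z-d<..<z} \<Longrightarrow> v \<in> {z<..<z+d} \<Longrightarrow> f u * f v > 0"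
      using loc[OF z(1)] unfolding same_sign_around_def by blast
    define e where "e = min d (min (z - x) (y - z)) / 2"
    have e: "e > 0" "e < d" "x < z - e" "z + e < y"
      using d z by (auto simp: e_def min_def field_simps split: if_splits)
    have uv: "f (z - e) * f (z + e) > 0" using d(2) e by simp
    then have nz: "f (z - e) \<noteq> 0" "f (z + e) \<noteq> 0" by auto
    have "f x * f (z - e) > 0"
    proof (rule less.hyps)
      show "card (positive_zeros f \<inter> {x<..<z - e}) < card (positive_zeros f \<inter> {x<..<y})"
      proof (rule psubset_card_mono)
        have "z \<in> positive_zeros f \<inter> {x<..<y}" "z \<notin> positive_zeros f \<inter> {x<..<z - e}" using z e by auto
        then show "positive_zeros f \<inter> {x<..<z - e} \<subset> positive_zeros f \<inter> {x<..<y}" using e by fastforce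
      qed (use fin in auto)
    qed (use less.prems e nz in auto)
    moreover have "f (z + e) * f y > 0"
    proof (rule less.hyps)
      show "card (positive_zeros f \<inter> {z + e<..<y}) < card (positive_zeros f \<inter> {x<..<y})"
      proof (rule psubset_card_mono)
        have "z \<in> positive_zeros f \<inter> {x<..<y}" "z \<notin> positive_zeros f \<inter> {z + e<..<y}" using z e by auto
        then show "positive_zeros f \<inter> {z + e<..<y} \<subset> positive_zeros f \<inter> {x<..<y}" using e by fastforce
      qed (use fin in auto)
    qed (use less.prems e nz in auto)
    ultimately show ?thesis using uv by (auto simp: zero_less_mult_iff)
  qed
qed

lemma changes_sign_at_simple_zero:
  fixes f :: "real \<Rightarrow> real"
  assumes "(f has_real_derivative D) (at z)" "f z = 0" "D \<noteq> 0"
  shows "changes_sign_at f z"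
proof -
  have pos: "changes_sign_at g z"
    if g: "(g has_real_derivative E) (at z)" "g z = 0" "E > 0" for g E
  proof -
    obtain d where d: "d > 0" "\<And>h. 0 < h \<Longrightarrow> h < d \<Longrightarrow> g z < g (z + h)"
      using DERIV_pos_inc_right[OF g(1,3)] by blast
    obtain e where e: "e > 0" "\<And>h. 0 < h \<Longrightarrow> h < e \<Longrightarrow> g (z - h) < g z"
      using DERIV_pos_inc_left[OF g(1,3)] by blast
    have "g x * g y < 0" if "x \<in> {z - min d e<..<z}" "y \<in> {z<..<z + min d e}" for x y
    proof -
      have "g y > 0" "g x < 0" using d(2)[of "y - z"] e(2)[of "z - x"] that g(2) by auto
      then show ?thesis by (rule mult_neg_pos[rotated])
    qed
    then show ?thesis unfolding changes_sign_at_def using d(1) e(1)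
      by (intro exI[of _ "min d e"]) auto
  qed
  show ?thesis
  proof (cases "D > 0")
    case True
    then show ?thesis using pos assms by blast
  next
    case False
    then have "changes_sign_at (\<lambda>x. - f x) z"
      using assms by (intro pos[of _ "-D"] DERIV_minus) auto
    then show ?thesis by (simp add: changes_sign_at_def)
  qed
qed

lemma same_sign_around_nonzero:
  fixes f :: "real \<Rightarrow> real"
  assumes "isCont f z" "f z \<noteq> 0"
  shows "same_sign_around f z"
proof -
  have "eventually (\<lambda>x. f x * f z > 0) (at z)"
  proof (rule order_tendstoD(1))
    show "((\<lambda>x. f x * f z) \<longlongrightarrow> f z * f z) (at z)"
      using assms(1) by (intro tendsto_intros) (simp add: isCont_def)
    show "0 < f z * f z" using assms(2) by (auto simp: zero_less_mult_iff)
  qed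
  then obtain d where d: "d > 0" "\<And>x. x \<noteq> z \<Longrightarrow> dist x z < d \<Longrightarrow> f x * f z > 0"
    unfolding eventually_at by blast
  have "f x * f y > 0" if "x \<in> {z - d<..<z}" "y \<in> {z<..<z + d}" for x y
    using d(2)[of x] d(2)[of y] that by (auto simp: dist_real_def zero_less_mult_iff)
  then show ?thesis unfolding same_sign_around_def using d(1) by blast
qed

text \<open>\<open>f'\<close> changes sign strictly at \<open>z\<close>, so \<open>f\<close> is
  strictly monotone in opposite directions on the two sides. Contrapositively, a double zero with a
  sign change has vanishing second derivative.\<close>

lemma strict_local_extremum_imp_same_sign_around:
  fixes f f' :: "real \<Rightarrow> real"
  assumes deriv: "\<And>x. (f has_real_derivative f' x) (at x)"
    and deriv2: "(f' has_real_derivative D) (at z)"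
    and "f z = 0" "f' z = 0" "D \<noteq> 0"
  shows "same_sign_around f z"
proof -
  have pos: "same_sign_around g z"
    if g: "\<And>x. (g has_real_derivative g' x) (at x)" "(g' has_real_derivative E) (at z)"
      "g z = 0" "g' z = 0" "E > 0" for g g' :: "real \<Rightarrow> real" and E
  proof -
    obtain d where d: "d > 0" "\<And>h. 0 < h \<Longrightarrow> h < d \<Longrightarrow> g' z < g' (z + h)"
      using DERIV_pos_inc_right[OF g(2,5)] by blast
    obtain e where e: "e > 0" "\<And>h. 0 < h \<Longrightarrow> h < e \<Longrightarrow> g' (z - h) < g' z"
      using DERIV_pos_inc_left[OF g(2,5)] by blast
    have cont: "continuous_on S g" for S
      using g(1) by (meson DERIV_continuous_on has_field_derivative_at_within)
    have R: "g y > 0" if "z < y" "y < z + d" for y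
    proof -
      have "\<exists>D. (g has_real_derivative D) (at x) \<and> D > 0" if "z < x" "x < y" for x
        using g(1) d(2)[of "x - z"] that \<open>y < z + d\<close> g(4) by (intro exI[of _ "g' x"]) auto
      then have "g z < g y" by (intro DERIV_pos_imp_increasing_open[OF that(1)] cont) auto
      then show ?thesis using g(3) by simp
    qed
    have L: "g x > 0" if "x < z" "z - e < x" for x
    proof -
      have "\<exists>D. (g has_real_derivative D) (at y) \<and> D < 0" if "x < y" "y < z" for y
        using g(1) e(2)[of "z - y"] that \<open>z - e < x\<close> g(4) by (intro exI[of _ "g' y"]) auto
      then have "g x > g z" by (intro DERIV_neg_imp_decreasing_open[OF that(1)] cont) auto
      then show ?thesis using g(3) by simp
    qed
    show ?thesis unfolding same_sign_around_def using d(1) e(1) L R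
      by (intro exI[of _ "min d e"]) auto
  qed
  show ?thesis
  proof (cases "D > 0")
    case True
    then show ?thesis using pos assms by blast
  next
    case False
    then have "same_sign_around (\<lambda>x. - f x) z"
      using assms by (intro pos[of _ "\<lambda>x. - f' x" "-D"] DERIV_minus) auto
    then show ?thesis by (simp add: same_sign_around_def)
  qed
qed

text \<open>Were both derivatives positive, \<open>f\<close> would be positive just after
  \<open>a\<close> and negative just before \<open>b\<close>, against its constant sign in between;
  the case of two negative ones is the same for \<open>- f\<close>.\<close>

lemma deriv_at_consecutive_zeros:
  fixes f :: "real \<Rightarrow> real"
  assumes "(f has_real_derivative A) (at a)" "(f has_real_derivative B) (at b)" "f a = 0" "f b = 0"
    and "a < b" "continuous_on {a..b} f" "\<And>x. a < x \<Longrightarrow> x < b \<Longrightarrow> f x \<noteq> 0"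
  shows "A * B \<le> 0"
proof -
  have "continuous_on {a<..<b} f"
    using assms(6) by (rule continuous_on_subset) auto
  note same = no_zeros_imp_same_sign[OF this assms(7)]
  have pos: False
    if g: "(g has_real_derivative A') (at a)" "(g has_real_derivative B') (at b)" "A' > 0" "B' > 0"
      "g a = 0" "g b = 0" "\<And>x y. a < x \<Longrightarrow> x < b \<Longrightarrow> a < y \<Longrightarrow> y < b \<Longrightarrow> g x * g y > 0" for g A' B'
  proof -
    obtain d where d: "d > 0" "\<And>h. 0 < h \<Longrightarrow> h < d \<Longrightarrow> g a < g (a + h)"
      using DERIV_pos_inc_right[OF g(1,3)] by blast
    obtain e where e: "e > 0" "\<And>h. 0 < h \<Longrightarrow> h < e \<Longrightarrow> g (b - h) < g b"
      using DERIV_pos_inc_left[OF g(2,4)] by blast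
    define h where "h = min d (min e (b - a)) / 2"
    have h: "0 < h" "h < d" "h < e" "h < b - a" using d(1) e(1) assms(5) by (auto simp: h_def)
    show False
      using d(2)[OF h(1,2)] e(2)[OF h(1,3)] g(7)[of "a + h" "b - h"] h g(5,6)
      by (auto simp: zero_less_mult_iff)
  qed
  show ?thesis
  proof (rule ccontr)
    assume "\<not> ?thesis"
    then have "A > 0 \<and> B > 0 \<or> - A > 0 \<and> - B > 0" by (auto simp: mult_le_0_iff not_le zero_less_mult_iff)
    then show False
      using pos[of f A B] pos[of "\<lambda>x. - f x" "- A" "- B"] assms same
      by (auto intro!: DERIV_minus)
  qed
qed

section \<open>The Jacobi amplitude and delta amplitude\<close>

lemma delta_bounds:
  fixes k :: real
  assumes "\<bar>k\<bar> < 1"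
  shows "0 < 1 - k\<^sup>2 * (sin \<phi>)\<^sup>2" "1 - k\<^sup>2 * (sin \<phi>)\<^sup>2 \<le> 1" "1 - k\<^sup>2 \<le> 1 - k\<^sup>2 * (sin \<phi>)\<^sup>2"
proof -
  have "k\<^sup>2 < 1" using assms by (simp add: abs_square_less_1)
  moreover have "(sin \<phi>)\<^sup>2 \<le> 1" by (simp add: abs_square_le_1)
  then have "k\<^sup>2 * (sin \<phi>)\<^sup>2 \<le> k\<^sup>2" by (simp add: mult_left_le)
  ultimately show "0 < 1 - k\<^sup>2 * (sin \<phi>)\<^sup>2" "1 - k\<^sup>2 \<le> 1 - k\<^sup>2 * (sin \<phi>)\<^sup>2" by auto
  show "1 - k\<^sup>2 * (sin \<phi>)\<^sup>2 \<le> 1" by simp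
qed

lemma has_real_derivative_elliptic_F:
  assumes "\<bar>k\<bar> < 1"
  shows "((\<lambda>\<phi>. elliptic_F \<phi> k) has_real_derivative 1 / sqrt (1 - k\<^sup>2 * (sin \<phi>)\<^sup>2)) (at \<phi>)"
proof -
  have nz: "1 - k\<^sup>2 * (sin \<theta>)\<^sup>2 > 0" for \<theta> using delta_bounds(1)[OF assms] .
  \<comment> \<open>The fundamental theorem is applied on a compact interval; this one has 0 and
    \<open>\<phi>\<close> in its interior.\<close>
  define A where "A = \<bar>\<phi>\<bar> + 1"
  have "((\<lambda>u. LBINT y=(0::real)..u. 1 / sqrt (1 - k\<^sup>2 * (sin y)\<^sup>2)) has_vector_derivative
      1 / sqrt (1 - k\<^sup>2 * (sin \<phi>)\<^sup>2)) (at \<phi> within {-A..A})"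
    using nz by (intro interval_integral_FTC2 continuous_intros) (auto simp: A_def less_imp_neq[symmetric])
  moreover have "at \<phi> within {-A..A} = at \<phi>"
    by (rule at_within_interior) (auto simp: A_def)
  ultimately show ?thesis
    by (simp add: elliptic_F_def has_real_derivative_iff_has_vector_derivative zero_ereal_def)
qed

lemma elliptic_F_0: "elliptic_F 0 k = 0"
  by (simp add: elliptic_F_def zero_ereal_def)

lemma elliptic_F_half_pi: "elliptic_F (pi / 2) k = elliptic_K k"
  by (simp add: elliptic_F_def elliptic_K_def)

lemma strict_mono_elliptic_F:
  assumes "\<bar>k\<bar> < 1" shows "strict_mono (\<lambda>\<phi>. elliptic_F \<phi> k)"
proof (rule strict_monoI)
  fix x y :: real assume "x < y"
  then show "elliptic_F x k < elliptic_F y k"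
    by (rule DERIV_pos_imp_increasing)
      (use has_real_derivative_elliptic_F[OF assms] delta_bounds(1)[OF assms] in \<open>auto intro!: exI\<close>)
qed

text \<open>The integrand is at least 1. Hence \<open>elliptic_F\<close> outgrows the identity in
  both directions, which makes it onto the real line.\<close>

lemma elliptic_F_minus_self_mono:
  assumes "\<bar>k\<bar> < 1" "x \<le> y" shows "elliptic_F x k - x \<le> elliptic_F y k - y"
proof (rule DERIV_nonneg_imp_nondecreasing[OF assms(2)])
  fix z
  have "1 / sqrt (1 - k\<^sup>2 * (sin z)\<^sup>2) \<ge> 1"
    using delta_bounds[OF assms(1), of z] by simp
  then show "\<exists>D. ((\<lambda>x. elliptic_F x k - x) has_real_derivative D) (at z) \<and> 0 \<le> D"
    using DERIV_diff[OF has_real_derivative_elliptic_F[OF assms(1), of z] DERIV_ident]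
    by (intro exI[of _ "1 / sqrt (1 - k\<^sup>2 * (sin z)\<^sup>2) - 1"]) auto
qed

lemma isCont_elliptic_F:
  assumes "\<bar>k\<bar> < 1" shows "isCont (\<lambda>\<phi>. elliptic_F \<phi> k) \<phi>"
  using has_real_derivative_elliptic_F[OF assms] by (rule DERIV_isCont)

text \<open>The description defining \<open>jacobi_am\<close> is proper: the intermediate value
  theorem between \<open>-\<bar>u\<bar>\<close> and \<open>\<bar>u\<bar>\<close> gives existence,
  strict monotonicity uniqueness.\<close>

lemma elliptic_F_jacobi_am:
  assumes "\<bar>k\<bar> < 1" shows "elliptic_F (jacobi_am u k) k = u"
proof -
  have "\<bar>u\<bar> \<le> elliptic_F \<bar>u\<bar> k" "elliptic_F (-\<bar>u\<bar>) k \<le> -\<bar>u\<bar>"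
    using elliptic_F_minus_self_mono[OF assms, of 0 "\<bar>u\<bar>"]
      elliptic_F_minus_self_mono[OF assms, of "-\<bar>u\<bar>" 0] by (auto simp: elliptic_F_0)
  then have "\<exists>x\<ge>-\<bar>u\<bar>. x \<le> \<bar>u\<bar> \<and> elliptic_F x k = u"
    using isCont_elliptic_F[OF assms] by (intro IVT) auto
  then have "\<exists>!x. elliptic_F x k = u"
    using strict_mono_eq[OF strict_mono_elliptic_F[OF assms]] by metis
  then show ?thesis unfolding jacobi_am_def by (rule theI')
qed

lemma jacobi_am_elliptic_F:
  assumes "\<bar>k\<bar> < 1" shows "jacobi_am (elliptic_F x k) k = x"
  using elliptic_F_jacobi_am[OF assms] strict_mono_eq[OF strict_mono_elliptic_F[OF assms]] by metis

text \<open>Inverse function rule: \<open>jacobi_dn\<close> is the reciprocal of the integrand of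
  \<open>elliptic_F\<close> at the amplitude.\<close>

lemma has_real_derivative_jacobi_am:
  assumes "\<bar>k\<bar> < 1"
  shows "((\<lambda>u. jacobi_am u k) has_real_derivative jacobi_dn u k) (at u)"
proof -
  have "isCont (\<lambda>u. jacobi_am u k) (elliptic_F (jacobi_am u k) k)"
    by (rule isCont_inverse_function[where d = 1])
      (auto simp: jacobi_am_elliptic_F isCont_elliptic_F assms)
  then have "((\<lambda>u. jacobi_am u k) has_real_derivative
      inverse (1 / sqrt (1 - k\<^sup>2 * (sin (jacobi_am u k))\<^sup>2))) (at u)"
    using delta_bounds(1)[OF assms, of "jacobi_am u k"] assms
    by (intro DERIV_inverse_function[where f = "\<lambda>x. elliptic_F x k" and a = "u - 1" and b = "u + 1"]
      has_real_derivative_elliptic_F) (auto simp: elliptic_F_jacobi_am)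
  then show ?thesis by (simp add: jacobi_dn_def)
qed

lemma strict_mono_jacobi_am:
  assumes "\<bar>k\<bar> < 1" shows "strict_mono (\<lambda>u. jacobi_am u k)"
proof (rule strict_monoI)
  fix u v :: real assume "u < v"
  then show "jacobi_am u k < jacobi_am v k"
    using strict_mono_less[OF strict_mono_elliptic_F[OF assms], of "jacobi_am u k" "jacobi_am v k"]
    by (simp add: elliptic_F_jacobi_am assms)
qed

lemma jacobi_am_0: "\<bar>k\<bar> < 1 \<Longrightarrow> jacobi_am 0 k = 0"
  using jacobi_am_elliptic_F[of k 0] by (simp add: elliptic_F_0)

lemma jacobi_am_K: "\<bar>k\<bar> < 1 \<Longrightarrow> jacobi_am (elliptic_K k) k = pi / 2"
  using jacobi_am_elliptic_F[of k "pi / 2"] by (simp add: elliptic_F_half_pi)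

lemma elliptic_K_pos: "\<bar>k\<bar> < 1 \<Longrightarrow> 0 < elliptic_K k"
  using strict_monoD[OF strict_mono_elliptic_F, of k 0 "pi / 2"]
  by (simp add: elliptic_F_0 elliptic_F_half_pi)

lemma jacobi_dn_pos: "\<bar>k\<bar> < 1 \<Longrightarrow> 0 < jacobi_dn u k"
  using delta_bounds(1)[of k "jacobi_am u k"] by (simp add: jacobi_dn_def)

lemma jacobi_dn_square: "\<bar>k\<bar> < 1 \<Longrightarrow> (jacobi_dn u k)\<^sup>2 = 1 - k\<^sup>2 * (sin (jacobi_am u k))\<^sup>2"
  using delta_bounds(1)[of k "jacobi_am u k"] by (simp add: jacobi_dn_def)

text \<open>The classical dn' = - k^2 sn cn, with sn and cn the sine and cosine of the
  amplitude.\<close>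

lemma has_real_derivative_jacobi_dn:
  assumes "\<bar>k\<bar> < 1"
  shows "((\<lambda>u. jacobi_dn u k) has_real_derivative
    - k\<^sup>2 * sin (jacobi_am u k) * cos (jacobi_am u k)) (at u)"
proof -
  have "((\<lambda>u. 1 - k\<^sup>2 * (sin (jacobi_am u k))\<^sup>2) has_real_derivative
      - (k\<^sup>2 * (2 * sin (jacobi_am u k) * (cos (jacobi_am u k) * jacobi_dn u k)))) (at u)"
    by (auto intro!: derivative_eq_intros has_real_derivative_jacobi_am assms)
  from DERIV_chain2[OF DERIV_real_sqrt[OF delta_bounds(1)[OF assms]] this]
  have "((\<lambda>u. jacobi_dn u k) has_real_derivative
      inverse (jacobi_dn u k) / 2 *
      - (k\<^sup>2 * (2 * sin (jacobi_am u k) * (cos (jacobi_am u k) * jacobi_dn u k)))) (at u)"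
    by (simp only: jacobi_dn_def[symmetric])
  then show ?thesis
    by (rule DERIV_cong) (use jacobi_dn_pos[OF assms, of u] in \<open>simp add: field_simps\<close>)
qed

section \<open>Variation diminishing for exponential moments\<close>

text \<open>Counting zeros rests on these two properties of \<open>y\<close>; the differential
  equations enter with \<open>dn_profile\<close>.\<close>

locale decreasing_profile =
  fixes y :: "real \<Rightarrow> real"
  assumes y_cont: "continuous_on {0..pi} y"
    and y_decreasing: "\<And>s t. 0 \<le> s \<Longrightarrow> s < t \<Longrightarrow> t \<le> pi \<Longrightarrow> y t < y s"
begin

text \<open>The \<open>j\<close>-th derivative in \<open>x\<close> of the Laplace-type transform of
  \<open>p\<close>: each differentiation of the exponential brings down
  \<open>- y \<theta>\<close>.\<close>

definition moment :: "(real \<Rightarrow> real) \<Rightarrow> nat \<Rightarrow> real \<Rightarrow> real" where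
  "moment p j x = integral {0..pi} (\<lambda>\<theta>. (- y \<theta>) ^ j * exp (- x * y \<theta>) * p \<theta>)"

lemma moment_integrable:
  assumes "continuous_on {0..pi} p"
  shows "(\<lambda>\<theta>. (- y \<theta>) ^ j * exp (- x * y \<theta>) * p \<theta>) integrable_on {0..pi}"
  by (intro integrable_continuous_real continuous_intros assms y_cont)

lemma has_real_derivative_moment:
  assumes p: "continuous_on {0..pi} p"
  shows "(moment p j has_real_derivative moment p (Suc j) x) (at x)"
proof -
  \<comment> \<open>Lifts continuity in \<open>\<theta>\<close> to joint continuity in
    \<open>x\<close> and \<open>\<theta>\<close>, as the Leibniz rule asks.\<close>
  have snd: "continuous_on (UNIV \<times> {0..pi}) (\<lambda>z::real \<times> real. h (snd z))"
    if "continuous_on {0..pi} h" for h :: "real \<Rightarrow> real"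
    by (rule continuous_on_compose2[OF that]) (auto intro!: continuous_intros)
  have "((\<lambda>x. integral (cbox 0 pi) (\<lambda>\<theta>. (- y \<theta>) ^ j * exp (- x * y \<theta>) * p \<theta>)) has_field_derivative
      integral (cbox 0 pi) (\<lambda>\<theta>. (- y \<theta>) ^ Suc j * exp (- x * y \<theta>) * p \<theta>)) (at x within UNIV)"
  proof (rule leibniz_rule_field_derivative)
    show "((\<lambda>x. (- y t) ^ j * exp (- x * y t) * p t) has_real_derivative
        (- y t) ^ Suc j * exp (- x * y t) * p t) (at x within UNIV)" for x t
      by (auto intro!: derivative_eq_intros)
    show "continuous_on (UNIV \<times> cbox 0 pi) (\<lambda>(x, t). (- y t) ^ Suc j * exp (- x * y t) * p t)"
      unfolding case_prod_beta cbox_interval by (intro continuous_intros snd p y_cont)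
  qed (use moment_integrable[OF p] in auto)
  then show ?thesis by (simp add: moment_def[abs_def])
qed

lemma isCont_moment: "continuous_on {0..pi} p \<Longrightarrow> isCont (moment p j) x"
  using has_real_derivative_moment by (rule DERIV_isCont)

lemma moment_cmult: "moment (\<lambda>\<theta>. c * p \<theta>) j x = c * moment p j x"
  unfolding moment_def by (simp add: mult.left_commute flip: integral_mult_right)

lemma moment_sum:
  assumes "finite J" "\<And>i. i \<in> J \<Longrightarrow> continuous_on {0..pi} (p i)"
  shows "moment (\<lambda>\<theta>. \<Sum>i\<in>J. p i \<theta>) j x = (\<Sum>i\<in>J. moment (p i) j x)"
  unfolding moment_def sum_distrib_left
  by (rule integral_sum) (use assms moment_integrable in auto)

text \<open>A factor \<open>y\<close> under the integral acts as minus differentiation in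
  \<open>x\<close>.\<close>

lemma moment_mult_profile:
  assumes p: "continuous_on {0..pi} p"
  shows "moment (\<lambda>\<theta>. p \<theta> * (y \<theta> - t)) j x = - moment p (Suc j) x - t * moment p j x"
proof -
  have "moment (\<lambda>\<theta>. p \<theta> * (y \<theta> - t)) j x =
      integral {0..pi} (\<lambda>\<theta>. - ((- y \<theta>) ^ Suc j * exp (- x * y \<theta>) * p \<theta>) - t * ((- y \<theta>) ^ j * exp (- x * y \<theta>) * p \<theta>))"
    unfolding moment_def by (rule integral_cong) (simp add: algebra_simps)
  also have "\<dots> = - moment p (Suc j) x - t * moment p j x"
    unfolding moment_def
    by (subst integral_diff)
      (auto intro!: integrable_continuous_real continuous_intros p y_cont simp del: power_Suc)
  finally show ?thesis .
qed

lemma moment_0_pos: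
  assumes "continuous_on {0..pi} p" "\<And>\<theta>. \<theta> \<in> {0..pi} \<Longrightarrow> 0 \<le> p \<theta>" "\<exists>\<theta>\<in>{0..pi}. p \<theta> \<noteq> 0"
  shows "0 < moment p 0 x"
proof -
  let ?f = "\<lambda>\<theta>. (- y \<theta>) ^ 0 * exp (- x * y \<theta>) * p \<theta>"
  have cont: "continuous_on {0..pi} ?f" by (intro continuous_intros assms y_cont)
  have nonneg: "?f \<theta> \<ge> 0" if "\<theta> \<in> {0..pi}" for \<theta> using assms(2)[OF that] by simp
  have "integral {0..pi} ?f \<noteq> 0"
    using integral_eq_0_iff[OF cont _ nonneg] assms(3) by auto
  moreover have "integral {0..pi} ?f \<ge> 0"
    by (rule integral_nonneg[OF integrable_continuous_real[OF cont]]) (use nonneg in auto)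
  ultimately show ?thesis by (simp add: moment_def)
qed

text \<open>\<open>y\<close> is injective on \<open>{0..pi}\<close>, so a vanishing product would
  leave \<open>p\<close> nonzero at a single point only, which continuity excludes.\<close>

lemma mult_profile_nonzero:
  assumes p: "continuous_on {0..pi} p" "\<exists>\<theta>\<in>{0..pi}. p \<theta> \<noteq> 0"
  shows "\<exists>\<theta>\<in>{0..pi}. p \<theta> * (y \<theta> - t) \<noteq> 0"
proof (rule ccontr)
  assume *: "\<not> ?thesis"
  obtain a where a: "a \<in> {0..pi}" "p a \<noteq> 0" using p(2) by blast
  have ya: "y a = t" using * a by auto
  have zero: "p b = 0" if "b \<in> {0..pi}" "b \<noteq> a" for b
  proof -
    have "y b \<noteq> y a"
      using y_decreasing[of a b] y_decreasing[of b a] that a by (cases "a < b") auto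
    then show ?thesis using * that ya by auto
  qed
  have "(p \<longlongrightarrow> p a) (at a within {0..pi})" using p(1) a(1) by (simp add: continuous_on_def)
  moreover have "(p \<longlongrightarrow> 0) (at a within {0..pi})"
    by (rule tendsto_eventually) (use zero in \<open>auto simp: eventually_at_filter\<close>)
  moreover have "at a within {0..pi} \<noteq> bot"
    using a(1) by (simp add: trivial_limit_within islimpt_Icc)
  ultimately show False using a(2) tendsto_unique by blast
qed

text \<open>Induction on \<open>T\<close>: up to sign, \<open>exp (- t * x)\<close> times the derivative of \<open>exp (t * x) * moment p 0 x\<close>
  is the moment of \<open>p * (y - t)\<close>, which needs one factor fewer, and Rolle's theorem loses only one zero.\<close>

lemma moment_zeros_with_multiplicity:
  assumes "continuous_on {0..pi} p" "\<exists>\<theta>\<in>{0..pi}. p \<theta> \<noteq> 0"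
    and "\<And>\<theta>. \<theta> \<in> {0..pi} \<Longrightarrow> 0 \<le> p \<theta> * (\<Prod>t\<leftarrow>T. y \<theta> - t)"
    and "finite Z" "\<And>z j. z \<in> Z \<Longrightarrow> j < \<mu> z \<Longrightarrow> moment p j z = 0"
  shows "(\<Sum>z\<in>Z. \<mu> z) \<le> length T"
  using assms
proof (induction T arbitrary: p Z \<mu>)
  case Nil
  \<comment> \<open>With no factor left, \<open>p\<close> is nonnegative and its transform strictly
    positive, so it has no zero.\<close>
  have "\<mu> z = 0" if "z \<in> Z" for z
    using moment_0_pos[of p z] Nil.prems(1,2,3) Nil.prems(5)[OF that, of 0] by fastforce
  then show ?case by simp
next
  case (Cons t T)
  note p = Cons.prems(1)
  define q where "q \<theta> = p \<theta> * (y \<theta> - t)" for \<theta>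
  have q: "moment q j x = - moment p (Suc j) x - t * moment p j x" for j x
    unfolding q_def by (rule moment_mult_profile[OF p])
  \<comment> \<open>Points with \<open>\<mu> z = 0\<close> are not known to be zeros and must not
    enter Rolle's theorem.\<close>
  define Z1 where "Z1 = {z\<in>Z. \<mu> z > 0}"
  have Z1: "finite Z1" "\<And>z. z \<in> Z1 \<Longrightarrow> moment p 0 z = 0"
    using Cons.prems by (auto simp: Z1_def)
  have "((\<lambda>x. exp (t * x) * moment p 0 x) has_real_derivative - (exp (t * x) * moment q 0 x)) (at x)" for x
    by (auto intro!: derivative_eq_intros has_real_derivative_moment[OF p] simp: q algebra_simps)
  from Rolle_finite_set[OF Z1(1) this] Z1(2)
  obtain W where W: "finite W" "W \<inter> Z1 = {}" "card Z1 \<le> Suc (card W)" "\<And>w. w \<in> W \<Longrightarrow> moment q 0 w = 0"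
    by auto
  \<comment> \<open>From \<open>p\<close> to \<open>q\<close> a zero loses one order, while the
    points from Rolle's theorem are new and counted once.\<close>
  define \<nu> where "\<nu> z = (if z \<in> Z1 then \<mu> z - 1 else 1)" for z
  have "(\<Sum>z\<in>Z1 \<union> W. \<nu> z) \<le> length T"
  proof (rule Cons.IH)
    show "continuous_on {0..pi} q" unfolding q_def by (intro continuous_intros p y_cont)
    show "\<exists>\<theta>\<in>{0..pi}. q \<theta> \<noteq> 0" unfolding q_def by (rule mult_profile_nonzero) (use Cons.prems in auto)
    show "0 \<le> q \<theta> * (\<Prod>t\<leftarrow>T. y \<theta> - t)" if "\<theta> \<in> {0..pi}" for \<theta>
      using Cons.prems(3)[OF that] by (simp add: q_def mult_ac)
    show "moment q j z = 0" if "z \<in> Z1 \<union> W" "j < \<nu> z" for z j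
    proof (cases "z \<in> Z1")
      case True
      then show ?thesis using that Cons.prems(5)[of z j] Cons.prems(5)[of z "Suc j"]
        by (simp add: q \<nu>_def Z1_def)
    next
      case False
      then show ?thesis using that W(4) by (auto simp: \<nu>_def)
    qed
  qed (use Z1 W in auto)
  moreover have "(\<Sum>z\<in>Z1 \<union> W. \<nu> z) = (\<Sum>z\<in>Z1. \<mu> z - 1) + card W"
  proof -
    have "(\<Sum>z\<in>W. \<nu> z) = (\<Sum>z\<in>W. 1)" using W(2) by (intro sum.cong) (auto simp: \<nu>_def)
    moreover have "(\<Sum>z\<in>Z1. \<nu> z) = (\<Sum>z\<in>Z1. \<mu> z - 1)" by (intro sum.cong) (auto simp: \<nu>_def)
    ultimately show ?thesis using W Z1 by (subst sum.union_disjoint) auto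
  qed
  moreover have "(\<Sum>z\<in>Z. \<mu> z) = (\<Sum>z\<in>Z1. \<mu> z)"
    using Cons.prems(4) by (intro sum.mono_neutral_right) (auto simp: Z1_def)
  moreover have "(\<Sum>z\<in>Z1. \<mu> z) = (\<Sum>z\<in>Z1. \<mu> z - 1) + card Z1"
  proof -
    have "(\<Sum>z\<in>Z1. \<mu> z) = (\<Sum>z\<in>Z1. (\<mu> z - 1) + 1)" by (intro sum.cong) (auto simp: Z1_def)
    then show ?thesis by (simp only: sum.distrib) simp
  qed
  ultimately show ?case using W(3) by simp
qed

text \<open>On \<open>{0..pi}\<close> both \<open>cos\<close> and \<open>y\<close> decrease, so
  \<open>t = y a\<close> with \<open>cos a = c\<close> makes both factors change sign at
  \<open>a\<close>. For \<open>c\<close> outside the range of \<open>cos\<close> an end value of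
  \<open>y\<close> serves.\<close>

lemma cos_minus_const_same_sign_profile:
  "\<exists>t. \<forall>\<theta>\<in>{0..pi}. 0 \<le> (cos \<theta> - c) * (y \<theta> - t)"
proof -
  have y_le: "y b \<le> y a" if "0 \<le> a" "a \<le> b" "b \<le> pi" for a b
    using y_decreasing[of a b] that by (cases "a = b") auto
  consider "c < -1" | "c > 1" | "-1 \<le> c \<and> c \<le> 1" by linarith
  then show ?thesis
  proof cases
    case 1
    have "cos \<theta> \<ge> c" for \<theta> using 1 cos_ge_minus_one[of \<theta>] by linarith
    then show ?thesis using y_le by (intro exI[of _ "y pi"]) (auto intro!: mult_nonneg_nonneg)
  next
    case 2
    have "cos \<theta> \<le> c" for \<theta> using 2 cos_le_one[of \<theta>] by linarith
    then show ?thesis using y_le by (intro exI[of _ "y 0"]) (auto intro!: mult_nonpos_nonpos)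
  next
    case 3
    define a where "a = arccos c"
    have a: "0 \<le> a" "a \<le> pi" "cos a = c" using 3 by (auto simp: a_def arccos_lbound arccos_ubound)
    have "0 \<le> (cos \<theta> - c) * (y \<theta> - y a)" if "\<theta> \<in> {0..pi}" for \<theta>
    proof (cases "\<theta> \<le> a")
      case True
      then have "c \<le> cos \<theta>" using cos_monotone_0_pi_le[of \<theta> a] that a by auto
      then show ?thesis using y_le[of \<theta> a] that a True by (intro mult_nonneg_nonneg) auto
    next
      case False
      then have "cos \<theta> \<le> c" using cos_monotone_0_pi_le[of a \<theta>] that a by auto
      then show ?thesis using y_le[of a \<theta>] that a False by (intro mult_nonpos_nonpos) auto
    qed
    then show ?thesis by blast
  qed
qed

text \<open>Each real linear factor split off from \<open>P\<close> contributes one \<open>t\<close>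
  by \<open>cos_minus_const_same_sign_profile\<close>. What remains has no real root, hence one
  sign, which \<open>\<sigma>\<close> absorbs.\<close>

lemma poly_cos_sign_profile:
  fixes P :: "real poly"
  assumes "P \<noteq> 0"
  shows "\<exists>T \<sigma>. length T \<le> degree P \<and> \<sigma> \<noteq> 0 \<and>
    (\<forall>\<theta>\<in>{0..pi}. 0 \<le> \<sigma> * poly P (cos \<theta>) * (\<Prod>t\<leftarrow>T. y \<theta> - t))"
  using assms
proof (induction "degree P" arbitrary: P rule: less_induct)
  case less
  show ?case
  proof (cases "\<exists>c. poly P c = 0")
    case True
    then obtain c Q where P: "P = [:- c, 1:] * Q" by (auto simp: poly_eq_0_iff_dvd elim: dvdE)
    with less.prems have Q: "Q \<noteq> 0" by auto
    then have deg: "degree P = Suc (degree Q)" unfolding P by (subst degree_mult_eq) auto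
    with less.hyps[of Q] Q obtain T \<sigma> where T: "length T \<le> degree Q" "\<sigma> \<noteq> 0"
      "\<And>\<theta>. \<theta> \<in> {0..pi} \<Longrightarrow> 0 \<le> \<sigma> * poly Q (cos \<theta>) * (\<Prod>t\<leftarrow>T. y \<theta> - t)" by auto
    obtain t where t: "\<And>\<theta>. \<theta> \<in> {0..pi} \<Longrightarrow> 0 \<le> (cos \<theta> - c) * (y \<theta> - t)"
      using cos_minus_const_same_sign_profile by blast
    have "0 \<le> \<sigma> * poly P (cos \<theta>) * (\<Prod>t\<leftarrow>t # T. y \<theta> - t)" if "\<theta> \<in> {0..pi}" for \<theta>
    proof -
      have "\<sigma> * poly P (cos \<theta>) * (\<Prod>t\<leftarrow>t # T. y \<theta> - t) =
          (\<sigma> * poly Q (cos \<theta>) * (\<Prod>t\<leftarrow>T. y \<theta> - t)) * ((cos \<theta> - c) * (y \<theta> - t))"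
        by (simp add: P algebra_simps)
      then show ?thesis using mult_nonneg_nonneg[OF T(3) t] that by metis
    qed
    then show ?thesis using T deg by (intro exI[of _ "t # T"] exI[of _ \<sigma>]) auto
  next
    case False
    have "0 \<le> poly P 0 * poly P c" for c
    proof (rule ccontr)
      assume neg: "\<not> ?thesis"
      then have "c \<noteq> 0" by auto
      with neg show False
        using poly_IVT[of 0 c P] poly_IVT[of c 0 P] False by (cases "c < 0") (auto simp: mult.commute)
    qed
    then show ?thesis using False by (intro exI[of _ "[]"] exI[of _ "poly P 0"]) auto
  qed
qed

text \<open>A polynomial of degree at most \<open>N\<close> in \<open>cos \<theta>\<close> has its
  sign matched by at most \<open>N\<close> factors \<open>y \<theta> - t\<close>, and each of them
  pays for one zero. Zeros on the whole real line count, the origin included.\<close>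

lemma cos_moment_zeros_with_multiplicity:
  fixes a :: "nat \<Rightarrow> real"
  assumes "\<exists>i\<le>N. a i \<noteq> 0" "finite Z"
    and zeros: "\<And>z j. z \<in> Z \<Longrightarrow> j < \<mu> z \<Longrightarrow> (\<Sum>i\<le>N. a i * moment (\<lambda>\<theta>. cos (real i * \<theta>)) j z) = 0"
  shows "(\<Sum>z\<in>Z. \<mu> z) \<le> N"
proof -
  obtain P :: "real poly" where P: "P \<noteq> 0" "degree P \<le> N"
      "\<And>x. poly P (cos x) = (\<Sum>i\<le>N. a i * cos (real i * x))"
    using cos_sum_polynomial[OF assms(1)] by blast
  obtain T \<sigma> where T: "length T \<le> degree P" "\<sigma> \<noteq> 0"
      "\<And>\<theta>. \<theta> \<in> {0..pi} \<Longrightarrow> 0 \<le> \<sigma> * poly P (cos \<theta>) * (\<Prod>t\<leftarrow>T. y \<theta> - t)"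
    using poly_cos_sign_profile[OF P(1)] by blast
  let ?p = "\<lambda>\<theta>. \<sigma> * (\<Sum>i\<le>N. a i * cos (real i * \<theta>))"
  have "moment ?p j x = \<sigma> * (\<Sum>i\<le>N. a i * moment (\<lambda>\<theta>. cos (real i * \<theta>)) j x)" for j x
    unfolding moment_cmult
    by (subst moment_sum) (auto intro!: continuous_intros simp: moment_cmult)
  then have "(\<Sum>z\<in>Z. \<mu> z) \<le> length T"
    using T assms cos_sum_nonzero[OF assms(1)]
    by (intro moment_zeros_with_multiplicity[of ?p]) (auto intro!: continuous_intros simp: P(3))
  then show ?thesis using T P by linarith
qed

end

section \<open>The self-adjoint differential equation\<close>

text \<open>Modelled on dn(K \<theta> / pi): \<open>\<omega>\<close> is the chain rule factor K / pi
  and \<open>r\<close> the complementary modulus. The equations are the classical ones for the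
  second derivative and the squared first derivative of dn; \<open>y'_ends\<close> removes boundary
  terms.\<close>

locale dn_profile = decreasing_profile +
  fixes y' :: "real \<Rightarrow> real" and r \<omega> :: real
  assumes r_pos: "0 < r" and \<omega>_pos: "0 < \<omega>"
    and y_bounds: "\<And>t. r \<le> y t" "\<And>t. y t \<le> 1"
    and y_deriv: "\<And>t. (y has_real_derivative y' t) (at t)"
    and y'_deriv: "\<And>t. (y' has_real_derivative \<omega>\<^sup>2 * (y t * (1 + r\<^sup>2 - 2 * (y t)\<^sup>2))) (at t)"
    and y'_square: "\<And>t. (y' t)\<^sup>2 = \<omega>\<^sup>2 * ((1 - (y t)\<^sup>2) * ((y t)\<^sup>2 - r\<^sup>2))"
    and y'_ends: "y' 0 = 0" "y' pi = 0"
begin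

abbreviation \<Phi> :: "nat \<Rightarrow> nat \<Rightarrow> real \<Rightarrow> real" where
  "\<Phi> n \<equiv> moment (\<lambda>\<theta>. cos (real n * \<theta>))"

lemma cos_cont: "continuous_on S (\<lambda>\<theta>. cos (real n * \<theta>))"
  by (intro continuous_intros)

lemmas \<Phi>_deriv [derivative_intros] = has_real_derivative_moment[OF cos_cont]

text \<open>Since \<open>y\<close> acts on \<open>exp (- x * y \<theta>)\<close> as \<open>- d/dx\<close>, the first-order equation for \<open>y\<close> turns
  \<open>d\<^sup>2/d\<theta>\<^sup>2\<close> into a differential operator in \<open>x\<close>.\<close>

lemma \<Phi>_ode:
  "x * ((1 + r\<^sup>2) * (x * \<Phi> n 2 x + \<Phi> n 1 x) - (x * \<Phi> n 4 x + 2 * \<Phi> n 3 x) - r\<^sup>2 * x * \<Phi> n 0 x)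
    = - ((real n / \<omega>)\<^sup>2 * \<Phi> n 0 x)"
proof -
  define f where "f j \<theta> = (- y \<theta>) ^ j * exp (- x * y \<theta>) * cos (real n * \<theta>)" for j \<theta>
  define I where "I \<theta> = x\<^sup>2 * (1 + r\<^sup>2) * f 2 \<theta> + x * (1 + r\<^sup>2) * f 1 \<theta> - x\<^sup>2 * f 4 \<theta> - 2 * x * f 3 \<theta>
    + ((real n / \<omega>)\<^sup>2 - x\<^sup>2 * r\<^sup>2) * f 0 \<theta>" for \<theta>
  \<comment> \<open>With \<open>u = exp (- x * y)\<close> and \<open>v = cos (n * \<theta>)\<close>,
    this is \<open>(u' * v - u * v') / \<omega>\<^sup>2\<close>, whose derivative is
    \<open>(u'' * v - u * v'') / \<omega>\<^sup>2\<close>. The equations for \<open>y\<close> turn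
    that into \<open>I\<close>.\<close>
  define G where "G \<theta> = (- x * y' \<theta> * exp (- x * y \<theta>) * cos (real n * \<theta>)
    + real n * exp (- x * y \<theta>) * sin (real n * \<theta>)) / \<omega>\<^sup>2" for \<theta>
  have "(I has_integral (G pi - G 0)) {0..pi}"
  proof (rule fundamental_theorem_of_calculus)
    fix t :: real
    define E C where "E = exp (- x * y t)" and "C = cos (real n * t)"
    have "(G has_real_derivative
        (- x * (\<omega>\<^sup>2 * (y t * (1 + r\<^sup>2 - 2 * (y t)\<^sup>2))) + x\<^sup>2 * (y' t)\<^sup>2 + (real n)\<^sup>2) * E * C / \<omega>\<^sup>2) (at t)"
      unfolding E_def C_def G_def[abs_def] using \<omega>_pos
      by (auto intro!: derivative_eq_intros y_deriv y'_deriv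
          simp: algebra_simps power2_eq_square add_divide_distrib diff_divide_distrib)
    moreover have "(- x * (\<omega>\<^sup>2 * (y t * (1 + r\<^sup>2 - 2 * (y t)\<^sup>2))) + x\<^sup>2 * (y' t)\<^sup>2 + (real n)\<^sup>2) * E * C / \<omega>\<^sup>2 = I t"
      using \<omega>_pos unfolding y'_square I_def f_def E_def[symmetric] C_def[symmetric]
      by (simp add: field_simps power2_eq_square power3_eq_cube power4_eq_xxxx)
    ultimately show "(G has_vector_derivative I t) (at t within {0..pi})"
      by (simp add: has_real_derivative_iff_has_vector_derivative[symmetric] has_field_derivative_at_within)
  qed simp
  \<comment> \<open>Both \<open>y'\<close> and \<open>sin (n * \<theta>)\<close> vanish at the two
    ends.\<close>
  moreover have "G pi - G 0 = 0"
    by (simp add: G_def y'_ends)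
  ultimately have "integral {0..pi} I = 0" by (metis integral_unique)
  moreover have "(I has_integral (x\<^sup>2 * (1 + r\<^sup>2) * \<Phi> n 2 x + x * (1 + r\<^sup>2) * \<Phi> n 1 x - x\<^sup>2 * \<Phi> n 4 x
      - 2 * x * \<Phi> n 3 x + ((real n / \<omega>)\<^sup>2 - x\<^sup>2 * r\<^sup>2) * \<Phi> n 0 x)) {0..pi}"
    unfolding moment_def I_def[abs_def] f_def[abs_def]
    by (intro has_integral_add has_integral_diff has_integral_mult_right integrable_integral
        moment_integrable cos_cont)
  ultimately have "x\<^sup>2 * (1 + r\<^sup>2) * \<Phi> n 2 x + x * (1 + r\<^sup>2) * \<Phi> n 1 x - x\<^sup>2 * \<Phi> n 4 x
      - 2 * x * \<Phi> n 3 x + ((real n / \<omega>)\<^sup>2 - x\<^sup>2 * r\<^sup>2) * \<Phi> n 0 x = 0"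
    by (metis integral_unique)
  then show ?thesis by (simp add: algebra_simps power2_eq_square)
qed

text \<open>The cosine integrates to zero over a whole number of half periods. This zero at the
  origin lowers the bound on positive zeros by one.\<close>

lemma \<Phi>_at_0: "1 \<le> n \<Longrightarrow> \<Phi> n 0 0 = 0"
proof -
  assume n: "1 \<le> n"
  have "((\<lambda>\<theta>. cos (real n * \<theta>)) has_integral (sin (real n * pi) / real n - sin (real n * 0) / real n)) {0..pi}"
  proof (rule fundamental_theorem_of_calculus)
    fix t :: real
    have "((\<lambda>t. sin (real n * t) / real n) has_real_derivative cos (real n * t)) (at t)"
      using n by (auto intro!: derivative_eq_intros)
    then show "((\<lambda>t. sin (real n * t) / real n) has_vector_derivative cos (real n * t)) (at t within {0..pi})"
      by (simp add: has_real_derivative_iff_has_vector_derivative[symmetric] has_field_derivative_at_within)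
  qed simp
  then show ?thesis by (simp add: moment_def sin_npi integral_unique)
qed

lemma \<Phi>_bound:
  assumes "0 \<le> x" shows "\<bar>\<Phi> n j x\<bar> \<le> pi * exp (- r * x)"
proof -
  have "norm (\<Phi> n j x) \<le> integral {0..pi} (\<lambda>_. exp (- r * x))"
    unfolding moment_def
  proof (rule integral_norm_bound_integral[OF moment_integrable[OF cos_cont]])
    fix t
    have "\<bar>- y t\<bar> ^ j \<le> 1" using y_bounds[of t] r_pos by (intro power_le_one) auto
    moreover have "exp (- x * y t) \<le> exp (- r * x)"
      using y_bounds(1)[of t] assms by (simp add: mult.commute[of r] mult_left_mono)
    moreover have "\<bar>cos (real n * t)\<bar> \<le> 1" by simp
    ultimately have "\<bar>- y t\<bar> ^ j * exp (- x * y t) * \<bar>cos (real n * t)\<bar> \<le> 1 * exp (- r * x) * 1"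
      by (intro mult_mono) auto
    then show "norm ((- y t) ^ j * exp (- x * y t) * cos (real n * t)) \<le> exp (- r * x)"
      by (simp add: abs_mult power_abs)
  qed auto
  then show ?thesis by simp
qed

text \<open>Since \<open>y\<close> is at least \<open>r\<close>, all moments are bounded by a
  multiple of \<open>exp (- r * x)\<close>, which beats every power. This disposes of boundary terms
  at infinity.\<close>

lemma \<Phi>_decay: "((\<lambda>x. x ^ m * \<Phi> n j x) \<longlongrightarrow> 0) at_top"
proof (rule Lim_null_comparison)
  show "\<forall>\<^sub>F x in at_top. norm (x ^ m * \<Phi> n j x) \<le> pi / r ^ m * ((r * x) ^ m / exp (r * x))"
    using eventually_ge_at_top[of 0]
  proof eventually_elim
    case (elim x)
    have "norm (x ^ m * \<Phi> n j x) = x ^ m * \<bar>\<Phi> n j x\<bar>" using elim by (simp add: abs_mult)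
    also have "\<dots> \<le> x ^ m * (pi * exp (- r * x))"
      using \<Phi>_bound[OF elim] elim by (intro mult_left_mono) auto
    also have "\<dots> = pi / r ^ m * ((r * x) ^ m / exp (r * x))"
      using r_pos by (simp add: power_mult_distrib exp_minus field_simps)
    finally show ?case .
  qed
  have "((\<lambda>x. (r * x) ^ m / exp (r * x)) \<longlongrightarrow> 0) at_top"
    by (rule filterlim_compose[OF tendsto_power_div_exp_0])
      (rule filterlim_tendsto_pos_mult_at_top[OF tendsto_const r_pos filterlim_ident])
  then show "((\<lambda>x. pi / r ^ m * ((r * x) ^ m / exp (r * x))) \<longlongrightarrow> 0) at_top"
    by (rule tendsto_mult_right_zero)
qed

text \<open>Divided by \<open>x\<close>, the operator of the preceding equation is formally self-adjoint:
  it is \<open>f \<mapsto> - (x f'')'' + (1 + r\<^sup>2) (x f')' - r\<^sup>2 x f\<close>. The boundary form is what Green's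
  formula for this operator leaves at the ends of an interval.\<close>

definition boundary_form :: "nat \<Rightarrow> nat \<Rightarrow> real \<Rightarrow> real" where
  "boundary_form n m x =
     (1 + r\<^sup>2) * (x * (\<Phi> n 0 x * \<Phi> m 1 x - \<Phi> m 0 x * \<Phi> n 1 x))
     - (\<Phi> n 0 x * (\<Phi> m 2 x + x * \<Phi> m 3 x) - x * \<Phi> n 1 x * \<Phi> m 2 x
        - \<Phi> m 0 x * (\<Phi> n 2 x + x * \<Phi> n 3 x) + x * \<Phi> m 1 x * \<Phi> n 2 x)"

text \<open>Lagrange's identity: the derivative is
  \<open>\<Phi> n 0 x * L m - \<Phi> m 0 x * L n\<close> with \<open>L\<close> the self-adjoint
  operator, and \<open>\<Phi>_ode\<close> evaluates \<open>x * L n\<close>. Multiplying by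
  \<open>x\<close> instead of dividing keeps the statement meaningful at 0.\<close>

lemma boundary_form_deriv:
  "\<exists>D. (boundary_form n m has_real_derivative D) (at x) \<and>
     x * D = ((real n)\<^sup>2 - (real m)\<^sup>2) / \<omega>\<^sup>2 * (\<Phi> n 0 x * \<Phi> m 0 x)"
proof -
  define L where "L n = (1 + r\<^sup>2) * (x * \<Phi> n 2 x + \<Phi> n 1 x) - (x * \<Phi> n 4 x + 2 * \<Phi> n 3 x) - r\<^sup>2 * x * \<Phi> n 0 x" for n
  have L: "x * L n = - ((real n / \<omega>)\<^sup>2 * \<Phi> n 0 x)" for n
    unfolding L_def by (rule \<Phi>_ode)
  have "x * (\<Phi> n 0 x * L m - \<Phi> m 0 x * L n) = \<Phi> n 0 x * (x * L m) - \<Phi> m 0 x * (x * L n)"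
    by (simp only: right_diff_distrib mult.left_commute)
  also have "\<dots> = ((real n)\<^sup>2 - (real m)\<^sup>2) / \<omega>\<^sup>2 * (\<Phi> n 0 x * \<Phi> m 0 x)"
  proof -
    have "a * - ((real m / \<omega>)\<^sup>2 * b) - b * - ((real n / \<omega>)\<^sup>2 * a)
        = ((real n)\<^sup>2 - (real m)\<^sup>2) / \<omega>\<^sup>2 * (a * b)" for a b :: real
      using \<omega>_pos by (simp add: field_simps)
    then show ?thesis unfolding L .
  qed
  finally have *: "x * (\<Phi> n 0 x * L m - \<Phi> m 0 x * L n) =
      ((real n)\<^sup>2 - (real m)\<^sup>2) / \<omega>\<^sup>2 * (\<Phi> n 0 x * \<Phi> m 0 x)" .
  have "(boundary_form n m has_real_derivative \<Phi> n 0 x * L m - \<Phi> m 0 x * L n) (at x)"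
    unfolding boundary_form_def[abs_def] L_def
    by (rule derivative_eq_intros refl)+ (simp_all add: eval_nat_numeral algebra_simps)
  from this * show ?thesis by (intro exI[of _ "\<Phi> n 0 x * L m - \<Phi> m 0 x * L n"] conjI)
qed

lemma boundary_form_0: "1 \<le> n \<Longrightarrow> 1 \<le> m \<Longrightarrow> boundary_form n m 0 = 0"
  by (simp add: boundary_form_def \<Phi>_at_0)

lemma boundary_form_at_top: "(boundary_form n m \<longlongrightarrow> 0) at_top"
proof -
  note lim = \<Phi>_decay[where m = 0, simplified] \<Phi>_decay[where m = 1, unfolded power_one_right]
  \<comment> \<open>Expanded so that each summand is a product of two factors tending to 0, any
    \<open>x\<close> being attached to one of them.\<close>
  define g where "g = (\<lambda>x. (1 + r\<^sup>2) * (x * \<Phi> n 0 x * \<Phi> m 1 x - x * \<Phi> m 0 x * \<Phi> n 1 x)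
     - (\<Phi> n 0 x * \<Phi> m 2 x + x * \<Phi> n 0 x * \<Phi> m 3 x - x * \<Phi> n 1 x * \<Phi> m 2 x
        - (\<Phi> m 0 x * \<Phi> n 2 x + x * \<Phi> m 0 x * \<Phi> n 3 x) + x * \<Phi> m 1 x * \<Phi> n 2 x))"
  have "boundary_form n m = g"
    by (simp add: g_def boundary_form_def[abs_def] algebra_simps)
  moreover have "(g \<longlongrightarrow> (1 + r\<^sup>2) * (0 * 0 - 0 * 0) - (0 * 0 + 0 * 0 - 0 * 0 - (0 * 0 + 0 * 0) + 0 * 0)) at_top"
    unfolding g_def by (intro tendsto_intros lim)
  ultimately show ?thesis by simp
qed

end

section \<open>Zeros of linear combinations\<close>

text \<open>\<open>W\<close> increases from 0 to the limit 0, so it is constant. This stands in for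
  the fact that a nonnegative continuous integrand with zero improper integral vanishes.\<close>

lemma nonneg_deriv_equal_limits_imp_deriv_0:
  fixes W W' :: "real \<Rightarrow> real"
  assumes deriv: "\<And>x. (W has_real_derivative W' x) (at x)"
    and nonneg: "\<And>x. 0 < x \<Longrightarrow> 0 \<le> W' x"
    and "W 0 = 0" and lim: "(W \<longlongrightarrow> 0) at_top" and "0 < x"
  shows "W' x = 0"
proof -
  have mono: "W s \<le> W t" if "0 \<le> s" "s \<le> t" for s t
  proof (rule DERIV_nonneg_imp_increasing_open[OF that(2)])
    show "\<exists>D. (W has_real_derivative D) (at u) \<and> 0 \<le> D" if "s < u" for u
      using deriv nonneg[of u] that \<open>0 \<le> s\<close> by auto
    show "continuous_on {s..t} W"
      using deriv by (meson DERIV_continuous_on has_field_derivative_at_within)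
  qed
  have zero: "W s = 0" if "0 < s" for s
  proof (rule antisym)
    have "\<forall>\<^sub>F t in at_top. W s \<le> W t"
      using eventually_ge_at_top[of s] by eventually_elim (use mono that in auto)
    then show "W s \<le> 0" by (rule tendsto_lowerbound[OF lim]) simp
    show "0 \<le> W s" using mono[of 0 s] that assms(3) by simp
  qed
  have "(W has_real_derivative 0) (at x)"
  proof (rule has_field_derivative_transform_within_open)
    show "((\<lambda>_. 0) has_real_derivative 0) (at x)" by simp
  qed (use zero \<open>0 < x\<close> in \<open>auto intro: open_greaterThan\<close>)
  then show ?thesis using deriv DERIV_unique by blast
qed

text \<open>At zeros of \<open>g\<close> the Wronskian is \<open>f * g'\<close>. It has the same
  sign at \<open>a\<close> and \<open>b\<close>, while \<open>g' a * g' b\<close> is not positive,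
  so \<open>f a\<close> and \<open>f b\<close> have opposite signs.\<close>

lemma changes_sign_between_zeros_if_wronskian_nonzero:
  fixes f g f' g' :: "real \<Rightarrow> real"
  assumes f: "\<And>x. (f has_real_derivative f' x) (at x)" and g: "\<And>x. (g has_real_derivative g' x) (at x)"
    and cont': "continuous_on UNIV f'" "continuous_on UNIV g'"
    and wronskian: "\<And>x. 0 < x \<Longrightarrow> f x * g' x - g x * f' x \<noteq> 0"
    and ab: "successive_positive_zeros g a b"
  shows "changes_sign_on f {a<..<b}"
proof -
  have cont: "continuous_on S f" "continuous_on S g" "continuous_on S f'" "continuous_on S g'" for S
    using f g cont'[THEN continuous_on_subset, of S]
    by (meson DERIV_continuous_on has_field_derivative_at_within subset_UNIV)+
  have ab': "0 < a" "a < b" "g a = 0" "g b = 0"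
    using ab by (auto simp: successive_positive_zeros_def positive_zeros_def)
  have nz: "g x \<noteq> 0" if "a < x" "x < b" for x
  proof
    assume "g x = 0"
    then have "x \<in> {a<..<b} \<inter> positive_zeros g" using that ab'(1) by (simp add: positive_zeros_def)
    then show False using ab by (auto simp: successive_positive_zeros_def)
  qed
  define W where "W x = f x * g' x - g x * f' x" for x
  have "W a * W b > 0"
  proof (rule no_zeros_imp_same_sign[of 0 "b + 1" W a b])
    show "continuous_on {0<..<b + 1} W" unfolding W_def by (intro continuous_intros cont)
    show "W x \<noteq> 0" if "0 < x" for x unfolding W_def by (rule wronskian[OF that])
  qed (use ab' in auto)
  then have "(f a * f b) * (g' a * g' b) > 0"
    by (simp add: W_def ab' mult_ac)
  moreover have "g' a * g' b \<le> 0"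
    by (rule deriv_at_consecutive_zeros[OF g g ab'(3,4,2) cont(2) nz])
  ultimately have fab: "f a * f b < 0"
    by (auto simp: zero_less_mult_iff mult_le_0_iff mult_less_0_iff)
  \<comment> \<open>The signs at the end points are carried into the open interval by
    continuity.\<close>
  have near: "\<exists>x\<in>{a<..<b}. 0 < f x * f c" if "c = a \<or> c = b" for c
  proof -
    have "f c \<noteq> 0" using fab that by auto
    then have pos: "0 < f c * f c" by (auto simp: zero_less_mult_iff)
    have "(f \<longlongrightarrow> f c) (at c within {a<..<b})"
      using DERIV_isCont[OF f[of c]] unfolding isCont_def by (rule tendsto_within_subset) simp
    then have "((\<lambda>x. f x * f c) \<longlongrightarrow> f c * f c) (at c within {a<..<b})"
      by (intro tendsto_intros)
    then have "\<forall>\<^sub>F x in at c within {a<..<b}. 0 < f x * f c"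
      using pos by (rule order_tendstoD(1))
    moreover have "\<forall>\<^sub>F x in at c within {a<..<b}. x \<in> {a<..<b}"
      by (auto simp: eventually_at_filter)
    ultimately have "\<forall>\<^sub>F x in at c within {a<..<b}. x \<in> {a<..<b} \<and> 0 < f x * f c"
      by eventually_elim auto
    moreover have "at c within {a<..<b} \<noteq> bot"
      using that ab'(2) by (auto simp: trivial_limit_within islimpt_greaterThanLessThan1 islimpt_greaterThanLessThan2)
    ultimately show ?thesis using eventually_happens' by blast
  qed
  obtain x y where xy: "x \<in> {a<..<b}" "0 < f x * f a" "y \<in> {a<..<b}" "0 < f y * f b"
    using near by blast
  then have "f x < 0 \<and> 0 < f y \<or> f y < 0 \<and> 0 < f x"
    using fab by (auto simp: zero_less_mult_iff mult_less_0_iff)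
  then show ?thesis unfolding changes_sign_on_def using xy by blast
qed

section \<open>Zero counts, orthogonality and sign changes of combinations of the
  \<open>\<Phi> n\<close>\<close>

context dn_profile
begin

text \<open>\<open>j\<close> is the order of differentiation, so that a multiple zero is expressed
  by \<open>comb N a j z = 0\<close> for several \<open>j\<close>.\<close>

definition comb :: "nat \<Rightarrow> (nat \<Rightarrow> real) \<Rightarrow> nat \<Rightarrow> real \<Rightarrow> real" where
  "comb N a j x = (\<Sum>i\<le>N. a i * \<Phi> i j x)"

lemma comb_deriv: "(comb N a j has_real_derivative comb N a (Suc j) x) (at x)"
  unfolding comb_def[abs_def] by (intro DERIV_sum DERIV_cmult \<Phi>_deriv)

lemma comb_cont: "continuous_on S (comb N a j)"
  by (intro continuous_at_imp_continuous_on ballI DERIV_isCont[OF comb_deriv])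

lemma comb_at_0: "a 0 = 0 \<Longrightarrow> comb N a 0 0 = 0"
  unfolding comb_def
proof (intro sum.neutral ballI)
  show "a i * \<Phi> i 0 0 = 0" if "a 0 = 0" for i
    using that \<Phi>_at_0[of i] by (cases i) auto
qed

text \<open>The bound \<open>N\<close> holds for zeros on the whole line; as \<open>a 0 = 0\<close>
  there is one more at the origin, whence the \<open>Suc\<close>.\<close>

lemma comb_zeros_with_multiplicity:
  assumes a: "\<exists>i\<le>N. a i \<noteq> 0" "a 0 = 0" and Z: "finite Z" "\<And>z. z \<in> Z \<Longrightarrow> 0 < z"
    and zeros: "\<And>z j. z \<in> Z \<Longrightarrow> j < \<mu> z \<Longrightarrow> comb N a j z = 0"
  shows "Suc (\<Sum>z\<in>Z. \<mu> z) \<le> N"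
proof -
  have "(\<Sum>z\<in>insert 0 Z. (\<mu>(0 := 1)) z) \<le> N"
  proof (rule cos_moment_zeros_with_multiplicity[OF a(1)])
    fix z j assume "z \<in> insert 0 Z" "j < (\<mu>(0 := 1)) z"
    then show "(\<Sum>i\<le>N. a i * \<Phi> i j z) = 0"
      using zeros[of z j] comb_at_0[of a N] a(2) unfolding comb_def by (auto split: if_splits)
  qed (use Z in auto)
  moreover have "0 \<notin> Z" using Z by auto
  moreover have "(\<Sum>z\<in>Z. (\<mu>(0 := 1)) z) = (\<Sum>z\<in>Z. \<mu> z)"
    using \<open>0 \<notin> Z\<close> by (intro sum.cong) auto
  ultimately show ?thesis using Z(1) by (simp add: sum.insert[of Z 0] del: fun_upd_apply) (simp add: fun_upd_same)
qed

lemma comb_positive_zeros: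
  assumes a: "\<exists>i\<le>N. a i \<noteq> 0" "a 0 = 0"
  shows "finite (positive_zeros (comb N a 0))" "card (positive_zeros (comb N a 0)) < N"
proof -
  have *: "card Z < N" if "finite Z" "Z \<subseteq> positive_zeros (comb N a 0)" for Z
    using comb_zeros_with_multiplicity[OF a that(1), of "\<lambda>_. 1"] that(2)
    by (auto simp: positive_zeros_def subset_iff)
  show fin: "finite (positive_zeros (comb N a 0))"
  proof (rule ccontr)
    assume "\<not> ?thesis"
    then show False using infinite_arbitrarily_large[of "positive_zeros (comb N a 0)" N] * by blast
  qed
  show "card (positive_zeros (comb N a 0)) < N" using *[OF fin] by simp
qed

text \<open>Orthogonality with respect to dx/x for disjoint index ranges, in the form used later: a
  product with integral zero that is never negative vanishes on the positive axis.\<close>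

lemma comb_orthogonal:
  assumes a: "\<And>i. i < p \<Longrightarrow> a i = 0" and b: "b 0 = 0" and "m < p"
    and nonneg: "\<And>x. 0 < x \<Longrightarrow> 0 \<le> comb q a 0 x * comb m b 0 x" and "0 < x"
  shows "comb q a 0 x * comb m b 0 x = 0"
proof -
  obtain B where B: "\<And>n m x. (boundary_form n m has_real_derivative B n m x) (at x)"
      "\<And>n m x. x * B n m x = ((real n)\<^sup>2 - (real m)\<^sup>2) / \<omega>\<^sup>2 * (\<Phi> n 0 x * \<Phi> m 0 x)"
    using boundary_form_deriv by metis
  \<comment> \<open>The weights undo the eigenvalue factors, so that \<open>x * W' x\<close> is the
    product of the two combinations. For \<open>i < p\<close> a denominator may be 0, but then
    \<open>a i = 0\<close>.\<close>
  define c where "c i l = a i * b l * (\<omega>\<^sup>2 / ((real i)\<^sup>2 - (real l)\<^sup>2))" for i l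
  define W where "W x = (\<Sum>i\<le>q. \<Sum>l\<le>m. c i l * boundary_form i l x)" for x
  define W' where "W' x = (\<Sum>i\<le>q. \<Sum>l\<le>m. c i l * B i l x)" for x
  have c_eq: "c i l * (((real i)\<^sup>2 - (real l)\<^sup>2) / \<omega>\<^sup>2 * s) = a i * b l * s" if "l \<le> m" for i l s
  proof (cases "i < p")
    case True
    then show ?thesis using a by (simp add: c_def)
  next
    case False
    then have "real l < real i" using that assms(3) by simp
    then have "(real l)\<^sup>2 < (real i)\<^sup>2" by (intro power_strict_mono) auto
    moreover have "i \<noteq> l" using \<open>real l < real i\<close> by auto
    ultimately show ?thesis using \<omega>_pos by (simp add: c_def)
  qed
  have W'_eq: "x * W' x = comb q a 0 x * comb m b 0 x" for x
  proof -
    have "x * W' x = (\<Sum>i\<le>q. \<Sum>l\<le>m. c i l * (x * B i l x))"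
      by (simp add: W'_def sum_distrib_left mult.left_commute)
    also have "\<dots> = (\<Sum>i\<le>q. \<Sum>l\<le>m. a i * b l * (\<Phi> i 0 x * \<Phi> l 0 x))"
      unfolding B(2) by (intro sum.cong refl c_eq) auto
    also have "\<dots> = comb q a 0 x * comb m b 0 x"
      by (simp add: comb_def sum_product mult_ac)
    finally show ?thesis .
  qed
  have "W' x = 0"
  proof (rule nonneg_deriv_equal_limits_imp_deriv_0[of W W' x])
    show "(W has_real_derivative W' x) (at x)" for x
      unfolding W_def[abs_def] W'_def by (auto intro!: derivative_eq_intros B(1) sum.cong)
    show "0 \<le> W' x" if "0 < x" for x
      using nonneg[OF that] W'_eq[of x] that by (metis zero_le_mult_iff not_less)
    show "W 0 = 0" unfolding W_def
    proof (intro sum.neutral ballI)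
      show "c i l * boundary_form i l 0 = 0" for i l
        using boundary_form_0[of i l] a[of 0] b assms(3)
        by (cases "i = 0 \<or> l = 0") (auto simp: c_def)
    qed
    have "(W \<longlongrightarrow> (\<Sum>i\<le>q. \<Sum>l\<le>m. c i l * 0)) at_top"
      unfolding W_def[abs_def] by (intro tendsto_intros boundary_form_at_top)
    then show "(W \<longlongrightarrow> 0) at_top" by simp
  qed fact
  then show ?thesis using W'_eq[of x] by simp
qed

text \<open>By contradiction: with fewer sign changes, some \<open>v\<close> built from indices
  below \<open>p\<close> copies them, so \<open>u * v\<close> has one sign and
  \<open>comb_orthogonal\<close> makes it vanish.\<close>

lemma comb_sign_changes:
  assumes a: "\<exists>i\<le>q. a i \<noteq> 0" "\<And>i. i < p \<Longrightarrow> a i = 0" and "1 \<le> p"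
  shows "p \<le> Suc (card {z \<in> positive_zeros (comb q a 0). changes_sign_at (comb q a 0) z})"
proof (rule ccontr)
  define u where "u = comb q a 0"
  define C where "C = {z \<in> positive_zeros u. changes_sign_at u z}"
  assume "\<not> ?thesis"
  then have m: "Suc (card C) < p" by (simp add: C_def u_def)
  have fin_u: "finite (positive_zeros u)"
    unfolding u_def by (rule comb_positive_zeros) (use a assms(3) in auto)
  then have C: "finite C" by (simp add: C_def)
  have C_pos: "\<And>z. z \<in> C \<Longrightarrow> 0 < z" by (simp add: C_def positive_zeros_def)
  \<comment> \<open>One coefficient more than there are points. Indices start at 1, so
    \<open>v\<close> also vanishes at the origin.\<close>
  obtain b0 where b0: "\<exists>j\<in>{1..Suc (card C)}. b0 j \<noteq> 0"
      "\<And>z. z \<in> C \<Longrightarrow> (\<Sum>j\<in>{1..Suc (card C)}. b0 j * \<Phi> j 0 z) = 0"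
    using homogeneous_system_nontrivial_solution[OF C, of "{1..Suc (card C)}" "\<lambda>j. \<Phi> j 0"] by auto
  define b where "b = b0(0 := 0)"
  obtain j where "1 \<le> j" "j \<le> Suc (card C)" "b0 j \<noteq> 0" using b0(1) by auto
  then have b: "\<exists>i\<le>Suc (card C). b i \<noteq> 0" "b 0 = 0"
    unfolding b_def by (intro exI[of _ j]) auto
  define v where "v = comb (Suc (card C)) b 0"
  have v_C: "v z = 0" if "z \<in> C" for z
  proof -
    have "v z = (\<Sum>j\<in>{1..Suc (card C)}. b0 j * \<Phi> j 0 z)"
      unfolding v_def comb_def by (rule sum.mono_neutral_cong_right) (auto simp: b_def)
    then show ?thesis using b0(2)[OF that] by simp
  qed
  \<comment> \<open>The zero count allows \<open>v\<close> only \<open>card C\<close> positive zeros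
    with multiplicity. The points of \<open>C\<close> use them up, so there are no others and each
    is simple.\<close>
  have v_zero: "z \<in> C \<and> comb (Suc (card C)) b 1 z \<noteq> 0" if "0 < z" "v z = 0" for z
  proof (rule ccontr)
    assume *: "\<not> ?thesis"
    \<comment> \<open>Either a double zero at a point of \<open>C\<close> or an extra zero outside;
      in both cases the total is \<open>card C + 1\<close>.\<close>
    define \<mu> where "\<mu> w = (if w = z \<and> z \<in> C then 2 else 1 :: nat)" for w
    have "Suc (\<Sum>w\<in>insert z C. \<mu> w) \<le> Suc (card C)"
    proof (rule comb_zeros_with_multiplicity[OF b])
      fix w j assume "w \<in> insert z C" "j < \<mu> w"
      then show "comb (Suc (card C)) b j w = 0"
      proof (cases "j = 0")
        case True
        have "v w = 0" using v_C that(2) \<open>w \<in> insert z C\<close> by blast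
        then show ?thesis using True by (simp add: v_def)
      next
        case False
        then have "w = z \<and> z \<in> C" "j = 1" using \<open>j < \<mu> w\<close> by (auto simp: \<mu>_def split: if_splits)
        then show ?thesis using * by simp
      qed
    qed (use C C_pos that in auto)
    moreover have "(\<Sum>w\<in>insert z C. \<mu> w) = Suc (card C)"
    proof -
      have "(\<Sum>w\<in>C - {z}. \<mu> w) = card (C - {z})" by (simp add: \<mu>_def)
      then show ?thesis using C card_Suc_Diff1[of C z] by (cases "z \<in> C") (auto simp: sum.insert_remove \<mu>_def)
    qed
    ultimately show False by simp
  qed
  define h where "h x = u x * v x" for x
  have h_zeros: "positive_zeros h \<subseteq> positive_zeros u"
    using v_zero by (auto simp: positive_zeros_def h_def C_def)
  then have fin_h: "finite (positive_zeros h)" using fin_u finite_subset by blast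
  have h_cont: "continuous_on {0<..} h"
    unfolding h_def u_def v_def by (intro continuous_intros comb_cont)
  have same: "same_sign_around h z" if z: "z \<in> positive_zeros h" for z
  proof -
    have "0 < z" "z \<in> positive_zeros u" using z h_zeros by (auto simp: positive_zeros_def)
    show ?thesis unfolding h_def
    \<comment> \<open>On \<open>C\<close> both factors change sign; at any other zero of
      \<open>h\<close>, \<open>u\<close> keeps its sign and \<open>v\<close> is nonzero.\<close>
    proof (rule same_sign_around_mult, cases "z \<in> C")
      case True
      then have "changes_sign_at v z"
        using v_zero[OF \<open>0 < z\<close>] v_C comb_deriv[of "Suc (card C)" b 0 z] unfolding v_def
        by (intro changes_sign_at_simple_zero) auto
      then show "changes_sign_at u z \<and> changes_sign_at v z \<or> same_sign_around u z \<and> same_sign_around v z"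
        using True by (simp add: C_def)
    next
      case False
      then have "v z \<noteq> 0" using v_zero \<open>0 < z\<close> by blast
      then have "same_sign_around v z"
        using DERIV_isCont[OF comb_deriv] unfolding v_def by (intro same_sign_around_nonzero) auto
      moreover have "same_sign_around u z"
        using isolated_zero_sign_cases[OF _ fin_u \<open>0 < z\<close>] comb_cont False \<open>z \<in> positive_zeros u\<close>
        by (auto simp: C_def u_def)
      ultimately show "changes_sign_at u z \<and> changes_sign_at v z \<or> same_sign_around u z \<and> same_sign_around v z"
        by blast
    qed
  qed
  have "\<not> {0<..} \<subseteq> positive_zeros h"
    using fin_h infinite_Ioi[of "0::real"] finite_subset by blast
  then obtain x0 where x0: "0 < x0" "h x0 \<noteq> 0" by (auto simp: positive_zeros_def)
  have h_sign: "0 \<le> h x0 * h x" if "0 < x" for x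
  proof (cases "h x = 0")
    case False
    then show ?thesis
      using same_sign_around_everywhere_imp_same_sign[OF h_cont fin_h same, of x x0]
        same_sign_around_everywhere_imp_same_sign[OF h_cont fin_h same, of x0 x] x0 that
      by (cases x x0 rule: linorder_cases) (auto simp: mult.commute)
  qed simp
  \<comment> \<open>The factor \<open>h x0\<close> turns constant sign into nonnegativity.\<close>
  define b' where "b' i = h x0 * b i" for i
  have b': "comb (Suc (card C)) b' 0 x = h x0 * v x" for x
    by (simp only: comb_def v_def b'_def sum_distrib_left mult.assoc)
  have "comb q a 0 x0 * comb (Suc (card C)) b' 0 x0 = 0"
  proof (rule comb_orthogonal[of p])
    show "0 \<le> comb q a 0 x * comb (Suc (card C)) b' 0 x" if "0 < x" for x
      using h_sign[OF that] unfolding b' by (simp add: h_def u_def[symmetric] mult_ac)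
  qed (use a b m x0 in \<open>auto simp: b'_def\<close>)
  then show False using x0(2) unfolding b' by (simp add: h_def u_def[symmetric])
qed

text \<open>There are at most \<open>n\<close> positive zeros with multiplicity and at least
  \<open>n - 1\<close> sign changes. A double zero that is no sign change adds 2 to these; one that
  is a sign change is at least triple. Either way the total reaches \<open>n + 1\<close>.\<close>

lemma comb_consecutive_simple_zeros:
  assumes a: "\<exists>i\<le>Suc n. a i \<noteq> 0" "\<And>i. i < n \<Longrightarrow> a i = 0" and "1 \<le> n"
    and z: "0 < z" "comb (Suc n) a 0 z = 0"
  shows "comb (Suc n) a 1 z \<noteq> 0"
proof
  assume z1: "comb (Suc n) a 1 z = 0"
  define u where "u = comb (Suc n) a"
  define C where "C = {z \<in> positive_zeros (u 0). changes_sign_at (u 0) z}"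
  have a0: "a 0 = 0" using a(2)[of 0] assms(3) by simp
  have fin: "finite C"
    using comb_positive_zeros(1)[OF a(1) a0] by (simp add: C_def u_def)
  have card: "n \<le> Suc (card C)"
    unfolding C_def u_def by (rule comb_sign_changes) (use a assms(3) in auto)
  have deriv: "(u j has_real_derivative u (Suc j) x) (at x)" for j x
    unfolding u_def by (rule comb_deriv)
  \<comment> \<open>A double zero with nonzero second derivative would be a strict local extremum,
    without sign change.\<close>
  have z2: "u 2 z = 0" if "z \<in> C"
  proof (rule ccontr)
    assume "u 2 z \<noteq> 0"
    then have "same_sign_around (u 0) z"
      using deriv[of 0] deriv[of 1 z] z z1
      by (intro strict_local_extremum_imp_same_sign_around[of "u 0" "u 1" "u 2 z" z])
        (auto simp: u_def numeral_2_eq_2)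
    then show False
      using that changes_sign_at_imp_not_same_sign_around unfolding C_def by blast
  qed
  define \<mu> where "\<mu> w = (if w = z then (if z \<in> C then 3 else 2) else 1 :: nat)" for w
  have "Suc (\<Sum>w\<in>insert z C. \<mu> w) \<le> Suc n"
  proof (rule comb_zeros_with_multiplicity[OF a(1) a0])
    fix w j assume "w \<in> insert z C" "j < \<mu> w"
    then show "comb (Suc n) a j w = 0"
      using z z1 z2
      by (auto simp: \<mu>_def u_def C_def positive_zeros_def less_Suc_eq numeral_2_eq_2 numeral_3_eq_3
          split: if_splits)
  qed (use fin z in \<open>auto simp: C_def positive_zeros_def\<close>)
  moreover have "(\<Sum>w\<in>insert z C. \<mu> w) = card C + 2"
  proof -
    have "(\<Sum>w\<in>C - {z}. \<mu> w) = card (C - {z})" by (simp add: \<mu>_def)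
    then have "(\<Sum>w\<in>insert z C. \<mu> w) = \<mu> z + card (C - {z})"
      by (simp only: sum.insert_remove[OF fin])
    also have "\<dots> = card C + 2"
      using card_Suc_Diff1[OF fin, of z] by (cases "z \<in> C") (auto simp: \<mu>_def)
    finally show ?thesis .
  qed
  ultimately show False using card by simp
qed

text \<open>The two bounds meet: at least \<open>n - 1\<close> sign changes, at most
  \<open>n - 1\<close> positive zeros.\<close>

theorem \<Phi>_positive_zeros:
  assumes "1 \<le> n"
  shows "finite (positive_zeros (\<Phi> n 0))" "card (positive_zeros (\<Phi> n 0)) = n - 1"
    "\<And>z. z \<in> positive_zeros (\<Phi> n 0) \<Longrightarrow> changes_sign_at (\<Phi> n 0) z"
proof -
  define a :: "nat \<Rightarrow> real" where "a i = (if i = n then 1 else 0)" for i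
  have \<Phi>: "comb n a 0 = \<Phi> n 0"
    by (rule ext) (simp add: comb_def a_def if_distrib[of "\<lambda>c. c * _"] sum.delta cong: if_cong)
  have a: "\<exists>i\<le>n. a i \<noteq> 0" "a 0 = 0" using assms by (auto simp: a_def)
  note zeros = comb_positive_zeros[OF a, unfolded \<Phi>]
  show "finite (positive_zeros (\<Phi> n 0))" by (rule zeros)
  let ?C = "{z \<in> positive_zeros (\<Phi> n 0). changes_sign_at (\<Phi> n 0) z}"
  have C: "n \<le> Suc (card ?C)"
    using comb_sign_changes[OF a(1), of n] assms unfolding \<Phi> by (auto simp: a_def)
  have sub: "?C \<subseteq> positive_zeros (\<Phi> n 0)" by auto
  have le: "card ?C \<le> card (positive_zeros (\<Phi> n 0))" by (rule card_mono[OF zeros(1) sub])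
  then show "card (positive_zeros (\<Phi> n 0)) = n - 1" using C zeros(2) by linarith
  have "?C = positive_zeros (\<Phi> n 0)"
    by (rule card_seteq[OF zeros(1) sub]) (use C zeros(2) in linarith)
  then show "changes_sign_at (\<Phi> n 0) z" if "z \<in> positive_zeros (\<Phi> n 0)" for z
    using that by blast
qed

text \<open>A vanishing Wronskian makes the pairs of value and derivative at \<open>z\<close>
  linearly dependent, so some nontrivial combination has a double zero there.\<close>

lemma \<Phi>_wronskian_nonzero:
  assumes "1 \<le> n" "0 < z"
  shows "\<Phi> n 0 z * \<Phi> (Suc n) 1 z - \<Phi> (Suc n) 0 z * \<Phi> n 1 z \<noteq> 0"
proof
  assume W: "\<Phi> n 0 z * \<Phi> (Suc n) 1 z - \<Phi> (Suc n) 0 z * \<Phi> n 1 z = 0"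
  have simple: False if "(\<alpha>, \<beta>) \<noteq> (0, 0)"
    "\<alpha> * \<Phi> n 0 z + \<beta> * \<Phi> (Suc n) 0 z = 0" "\<alpha> * \<Phi> n 1 z + \<beta> * \<Phi> (Suc n) 1 z = 0" for \<alpha> \<beta>
  proof -
    define a where "a i = (if i = n then \<alpha> else if i = Suc n then \<beta> else 0)" for i
    have comb: "comb (Suc n) a j x = \<alpha> * \<Phi> n j x + \<beta> * \<Phi> (Suc n) j x" for j x
    proof -
      have "comb (Suc n) a j x = (\<Sum>i\<in>{n, Suc n}. a i * \<Phi> i j x)"
        unfolding comb_def by (rule sum.mono_neutral_right) (auto simp: a_def)
      then show ?thesis by (simp add: a_def)
    qed
    have "a n \<noteq> 0 \<or> a (Suc n) \<noteq> 0" using that(1) by (auto simp: a_def)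
    then have "\<exists>i\<le>Suc n. a i \<noteq> 0" using le_SucI[OF order_refl] order_refl by blast
    then show False using comb_consecutive_simple_zeros[of n a z] assms that(2,3)
      by (auto simp: comb a_def)
  qed
  show False
  proof (cases "\<Phi> n 0 z = 0 \<and> \<Phi> (Suc n) 0 z = 0")
    case False
    \<comment> \<open>These coefficients annihilate the values identically and the derivatives
      because the Wronskian is 0.\<close>
    then show False using simple[of "\<Phi> (Suc n) 0 z" "- \<Phi> n 0 z"] W by (auto simp: algebra_simps)
  next
    case True
    show False
    proof (cases "\<Phi> n 1 z = 0 \<and> \<Phi> (Suc n) 1 z = 0")
      case False
      \<comment> \<open>Both values being 0, it is enough to annihilate the derivatives.\<close>
      then show False using simple[of "\<Phi> (Suc n) 1 z" "- \<Phi> n 1 z"] True by (auto simp: algebra_simps)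
    next
      case d: True
      then show False using simple[of 1 0] True by simp
    qed
  qed
qed

theorem \<Phi>_changes_sign_between_zeros:
  assumes "1 \<le> n" "successive_positive_zeros (\<Phi> (Suc n) 0) a b"
  shows "changes_sign_on (\<Phi> n 0) {a<..<b}"
proof -
  have deriv: "(\<Phi> m 0 has_real_derivative \<Phi> m 1 x) (at x)" for m x
    using \<Phi>_deriv[of m 0 x] by simp
  have cont: "continuous_on UNIV (\<Phi> m 1)" for m
    by (intro continuous_at_imp_continuous_on ballI isCont_moment cos_cont)
  show ?thesis
    by (rule changes_sign_between_zeros_if_wronskian_nonzero
        [where f = "\<Phi> n 0" and f' = "\<Phi> n 1" and g = "\<Phi> (Suc n) 0" and g' = "\<Phi> (Suc n) 1",
         OF deriv deriv cont cont \<Phi>_wronskian_nonzero[OF assms(1)] assms(2)])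
qed

end

section \<open>Application to the delta amplitude\<close>

text \<open>On \<open>{0..pi}\<close> the argument runs from 0 to K and the amplitude from 0 to
  \<open>pi / 2\<close>. Sine and cosine are positive strictly between, which gives strict decrease.
  As k^2 = 1 - r^2, the minimum of dn is \<open>r\<close>.\<close>

lemma jacobi_dn_profile:
  fixes r :: real
  assumes "0 < r" "r < 1"
  defines "k \<equiv> sqrt (1 - r\<^sup>2)"
  defines "\<omega> \<equiv> elliptic_K k / pi"
  shows "dn_profile (\<lambda>\<theta>. jacobi_dn (elliptic_K k * \<theta> / pi) k)
    (\<lambda>\<theta>. - \<omega> * k\<^sup>2 * sin (jacobi_am (elliptic_K k * \<theta> / pi) k) * cos (jacobi_am (elliptic_K k * \<theta> / pi) k)) r \<omega>"
proof -
  have r2: "0 < r\<^sup>2" "r\<^sup>2 < 1" using assms(1,2) power_strict_mono[of r 1 2] by auto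
  have k2: "k\<^sup>2 = 1 - r\<^sup>2" using r2 by (simp add: k_def)
  have k_pos: "0 < k" using r2 by (simp add: k_def)
  have k: "\<bar>k\<bar> < 1" using k2 r2 abs_square_less_1[of k] by simp
  define \<phi> where "\<phi> \<theta> = jacobi_am (elliptic_K k * \<theta> / pi) k" for \<theta>
  define y where "y \<theta> = jacobi_dn (elliptic_K k * \<theta> / pi) k" for \<theta>
  define y' where "y' \<theta> = - \<omega> * k\<^sup>2 * sin (\<phi> \<theta>) * cos (\<phi> \<theta>)" for \<theta>
  have \<omega>: "0 < \<omega>" using elliptic_K_pos[OF k] by (simp add: \<omega>_def)
  have y2: "(y \<theta>)\<^sup>2 = 1 - k\<^sup>2 * (sin (\<phi> \<theta>))\<^sup>2" for \<theta>
    unfolding y_def \<phi>_def by (rule jacobi_dn_square[OF k])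
  have y_pos: "0 < y \<theta>" for \<theta> unfolding y_def by (rule jacobi_dn_pos[OF k])
  have lin: "((\<lambda>\<theta>. elliptic_K k * \<theta> / pi) has_real_derivative \<omega>) (at \<theta>)" for \<theta>
    unfolding \<omega>_def by (auto intro!: derivative_eq_intros)
  have \<phi>_deriv: "(\<phi> has_real_derivative y \<theta> * \<omega>) (at \<theta>)" for \<theta>
    unfolding \<phi>_def[abs_def] y_def by (rule DERIV_chain2[OF has_real_derivative_jacobi_am[OF k] lin])
  have y_deriv: "(y has_real_derivative y' \<theta>) (at \<theta>)" for \<theta>
    using DERIV_chain2[OF has_real_derivative_jacobi_dn[OF k] lin]
    unfolding y_def[abs_def] y'_def \<phi>_def by (rule DERIV_cong) (simp add: mult_ac)
  have \<phi>_0: "\<phi> 0 = 0" and \<phi>_pi: "\<phi> pi = pi / 2"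
    by (simp_all add: \<phi>_def jacobi_am_0 jacobi_am_K k)
  have \<phi>_mono: "\<phi> s < \<phi> t" if "s < t" for s t
    unfolding \<phi>_def using that elliptic_K_pos[OF k]
    by (intro strict_monoD[OF strict_mono_jacobi_am[OF k]]) (simp add: divide_strict_right_mono)
  have y_cont: "continuous_on S y" for S
    using y_deriv by (meson DERIV_continuous_on has_field_derivative_at_within)
  have "dn_profile y y' r \<omega>"
  proof unfold_locales
    show "y t < y s" if "0 \<le> s" "s < t" "t \<le> pi" for s t
    proof (rule DERIV_neg_imp_decreasing_open[OF that(2) _ y_cont])
      fix x assume x: "s < x" "x < t"
      have "0 < \<phi> x" "\<phi> x < pi / 2"
        using \<phi>_mono[of 0 x] \<phi>_mono[of x pi] x that by (simp_all add: \<phi>_0 \<phi>_pi)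
      then have "0 < sin (\<phi> x)" "0 < cos (\<phi> x)" by (auto intro: sin_gt_zero cos_gt_zero)
      then have "y' x < 0" using \<omega> k_pos by (simp add: y'_def)
      then show "\<exists>D. (y has_real_derivative D) (at x) \<and> D < 0" using y_deriv by blast
    qed
    have sq: "r\<^sup>2 \<le> (y t)\<^sup>2" "(y t)\<^sup>2 \<le> 1\<^sup>2" for t
      using delta_bounds(2,3)[OF k, of "\<phi> t"] by (simp_all add: y2 k2)
    show "r \<le> y t" "y t \<le> 1" for t
      using power2_le_imp_le[OF sq(1)[of t]] power2_le_imp_le[OF sq(2)[of t]] y_pos[of t] by simp_all
    show "(y' has_real_derivative \<omega>\<^sup>2 * (y t * (1 + r\<^sup>2 - 2 * (y t)\<^sup>2))) (at t)" for t
    proof -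
      have "(y' has_real_derivative
          - \<omega> * k\<^sup>2 * ((cos (\<phi> t))\<^sup>2 - (sin (\<phi> t))\<^sup>2) * (y t * \<omega>)) (at t)"
        unfolding y'_def[abs_def]
        by (auto intro!: derivative_eq_intros \<phi>_deriv simp: power2_eq_square algebra_simps)
      moreover have "- \<omega> * k\<^sup>2 * ((cos (\<phi> t))\<^sup>2 - (sin (\<phi> t))\<^sup>2) * (y t * \<omega>)
          = \<omega>\<^sup>2 * (y t * (1 + r\<^sup>2 - 2 * (y t)\<^sup>2))"
      proof -
        have *: "1 + r\<^sup>2 - 2 * (y t)\<^sup>2 = - (k\<^sup>2 * ((cos (\<phi> t))\<^sup>2 - (sin (\<phi> t))\<^sup>2))"
          unfolding y2 cos_squared_eq by (simp add: k2 algebra_simps)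
        show ?thesis unfolding * power2_eq_square[of \<omega>] by (simp only: mult_ac mult_minus_left mult_minus_right)
      qed
      ultimately show ?thesis by simp
    qed
    show "(y' t)\<^sup>2 = \<omega>\<^sup>2 * ((1 - (y t)\<^sup>2) * ((y t)\<^sup>2 - r\<^sup>2))" for t
    proof -
      have "1 - (y t)\<^sup>2 = k\<^sup>2 * (sin (\<phi> t))\<^sup>2" "(y t)\<^sup>2 - r\<^sup>2 = k\<^sup>2 * (cos (\<phi> t))\<^sup>2"
        unfolding y2 cos_squared_eq by (simp_all add: k2 algebra_simps)
      then show ?thesis by (simp add: y'_def power2_eq_square mult_ac)
    qed
    show "y' 0 = 0" "y' pi = 0" by (simp_all add: y'_def \<phi>_0 \<phi>_pi)
  qed (fact assms(1) \<omega> y_deriv y_cont)+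
  then show ?thesis unfolding y_def[abs_def] y'_def[abs_def] \<phi>_def .
qed

section \<open>Invariance under the normalising factor\<close>

lemma positive_zeros_cmult: "c \<noteq> 0 \<Longrightarrow> positive_zeros (\<lambda>x. c * f x) = positive_zeros f"
  by (simp add: positive_zeros_def)

lemma changes_sign_at_cmult: "c > 0 \<Longrightarrow> changes_sign_at (\<lambda>x. c * f x) z = changes_sign_at f z"
proof -
  assume "c > 0"
  then have "c * f x * (c * f y) < 0 \<longleftrightarrow> f x * f y < 0" for x y
    by (auto simp: mult_less_0_iff zero_less_mult_iff)
  then show ?thesis by (simp add: changes_sign_at_def)
qed

lemma changes_sign_on_cmult: "c > 0 \<Longrightarrow> changes_sign_on (\<lambda>x. c * f x) S = changes_sign_on f S"
  by (simp add: changes_sign_on_def mult_less_0_iff zero_less_mult_iff)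

theorem theorem3p23:
  fixes r :: real
  assumes "0 < r" and "r < 1"
  shows "(\<forall>n\<ge>1. finite (positive_zeros (Phi_tilde r n)) \<and>
             card (positive_zeros (Phi_tilde r n)) = n - 1 \<and>
             (\<forall>z\<in>positive_zeros (Phi_tilde r n). changes_sign_at (Phi_tilde r n) z)) \<and>
         (\<forall>n\<ge>2. \<forall>a b. successive_positive_zeros (Phi_tilde r (n + 1)) a b \<longrightarrow>
             changes_sign_on (Phi_tilde r n) {a<..<b})"
proof -
  define k where "k = sqrt (1 - r\<^sup>2)"
  define y where "y \<theta> = jacobi_dn (elliptic_K k * \<theta> / pi) k" for \<theta>
  obtain y' \<omega> where "dn_profile y y' r \<omega>"
    using jacobi_dn_profile[OF assms] unfolding y_def[abs_def] k_def by blast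
  then interpret dn_profile y y' r \<omega> .
  have Phi: "Phi_tilde r n = (\<lambda>x. 1 / pi * \<Phi> n 0 x)" for n
  proof
    fix x
    let ?f = "\<lambda>\<theta>. exp (- x * y \<theta>) * cos (real n * \<theta>)"
    \<comment> \<open>\<open>Phi_tilde\<close> is defined by the Lebesgue interval integral, the
      moments by the gauge integral; they agree for continuous integrands.\<close>
    have "(LBINT \<theta>=0..pi. ?f \<theta>) = integral {0..pi} ?f"
      unfolding zero_ereal_def
      by (intro interval_integral_eq_integral borel_integrable_atLeastAtMost' continuous_intros y_cont) simp
    then show "Phi_tilde r n x = 1 / pi * \<Phi> n 0 x"
      by (simp add: Phi_tilde_def moment_def y_def k_def Let_def)
  qed
  have c: "(1 / pi :: real) > 0" "(1 / pi :: real) \<noteq> 0" by auto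
  have succ: "successive_positive_zeros (\<lambda>x. 1 / pi * f x) a b \<longleftrightarrow> successive_positive_zeros f a b" for f a b
    unfolding successive_positive_zeros_def positive_zeros_cmult[OF c(2)] ..
  show ?thesis
    unfolding Phi positive_zeros_cmult[OF c(2)] changes_sign_at_cmult[OF c(1)]
      changes_sign_on_cmult[OF c(1)] succ
    using \<Phi>_positive_zeros \<Phi>_changes_sign_between_zeros by simp
qed

end
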